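(* Let $D\subset\mathbb{C}^3$ be the vanishing locus of $F_{B,5}=xy^4+y^3z+z^3$. Then the Lie algebroid $T_{\mathbb{C}^3}(-\log D)$ is not isomorphic to an action algebroid.
   Context: $T_{\mathbb{C}^3}(-\log D)$ is the logarithmic tangent bundle: the sheaf of holomorphic vector fields preserving the reduced ideal of $D$. It is locally free ($D$ is a free divisor) and is a holomorphic Lie algebroid over $\mathbb{C}^3$, with the Lie bracket of vector fields and anchor the inclusion into the tangent sheaf. A basis is $E=x\partial_x+2y\partial_y+3z\partial_z$, $V=2y\partial_x+(-24xy+2z)\partial_y+(-2y^2-32xz)\partial_z$, $W=3z\partial_x-9y^2\partial_y-12yz\partial_z$. An action algebroid is a Lie algebroid $\mathfrak{g}\ltimes\mathbb{C}^3$ associated to a finite-dimensional complex Lie algebra $\mathfrak{g}$ and a Lie algebra homomorphism from $\mathfrak{g}$ to holomorphic vector fields on $\mathbb{C}^3$: the trivial bundle $\mathfrak{g}\times\mathbb{C}^3$ with anchor given by the action and bracket of constant sections given by the bracket of $\mathfrak{g}$. Isomorphism means isomorphism of holomorphic Lie algebroids. *)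

theory Defs
  imports "HOL-Analysis.Analysis"
begin

section \<open>Holomorphic functions and vector fields on open subsets of complex 3-space\<close>

text \<open>Coordinates are \<open>x = p $ 1\<close>, \<open>y = p $ 2\<close>, \<open>z = p $ 3\<close>.\<close>

type_synonym cspace = "complex ^ 3"

text \<open>Complex differentiability in several variables: the real Frechet derivative exists and is
  complex linear. Only used for open \<open>U\<close>.\<close>

definition holo_on :: "cspace set \<Rightarrow> (cspace \<Rightarrow> complex) \<Rightarrow> bool" where
  "holo_on U f \<longleftrightarrow>
     (\<forall>p\<in>U. \<exists>f'. (f has_derivative f') (at p) \<and> (\<forall>c v. f' (c *s v) = c * f' v))"

text \<open>Sections over \<open>U\<close> are represented by functions that are \<^const>\<open>undefined\<close> outside \<open>U\<close>, so
  that equality of sections is equality of functions. Derivatives at points of an open \<open>U\<close> do not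
  depend on this convention.\<close>

definition holo_functions :: "cspace set \<Rightarrow> (cspace \<Rightarrow> complex) set" where
  "holo_functions U = {f \<in> extensional U. holo_on U f}"

definition holo_vector_fields :: "cspace set \<Rightarrow> (cspace \<Rightarrow> cspace) set" where
  "holo_vector_fields U = {X \<in> extensional U. \<forall>i. holo_on U (\<lambda>p. X p $ i)}"

definition vf_apply :: "(cspace \<Rightarrow> cspace) \<Rightarrow> (cspace \<Rightarrow> complex) \<Rightarrow> cspace \<Rightarrow> complex" where
  "vf_apply X f p = frechet_derivative f (at p) (X p)"

definition vf_bracket :: "(cspace \<Rightarrow> cspace) \<Rightarrow> (cspace \<Rightarrow> cspace) \<Rightarrow> cspace \<Rightarrow> cspace" where
  "vf_bracket X Y p =
     (\<chi> i. vf_apply X (\<lambda>q. Y q $ i) p - vf_apply Y (\<lambda>q. X q $ i) p)"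


section \<open>Lie algebroids over complex 3-space and their isomorphisms\<close>

text \<open>The data of a Lie algebroid, given by its sheaf of sections. The first argument of each
  operation is the open set over which it acts; \<open>la_restrict A U V\<close> restricts from \<open>U\<close> to \<open>V\<close>.\<close>

record 's lie_algebroid =
  la_sections :: "cspace set \<Rightarrow> 's set"
  la_restrict :: "cspace set \<Rightarrow> cspace set \<Rightarrow> 's \<Rightarrow> 's"
  la_add :: "cspace set \<Rightarrow> 's \<Rightarrow> 's \<Rightarrow> 's"
  la_smult :: "cspace set \<Rightarrow> (cspace \<Rightarrow> complex) \<Rightarrow> 's \<Rightarrow> 's"
  la_bracket :: "cspace set \<Rightarrow> 's \<Rightarrow> 's \<Rightarrow> 's"
  la_anchor :: "cspace set \<Rightarrow> 's \<Rightarrow> cspace \<Rightarrow> cspace"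

text \<open>Isomorphisms cover the identity of the base: they are isomorphisms of sheaves of modules over
  the holomorphic functions, compatible with brackets and anchors.\<close>

definition lie_algebroid_iso ::
  "'s lie_algebroid \<Rightarrow> 't lie_algebroid \<Rightarrow> (cspace set \<Rightarrow> 's \<Rightarrow> 't) \<Rightarrow> bool" where
  "lie_algebroid_iso A B \<phi> \<longleftrightarrow>
     (\<forall>U. open U \<longrightarrow>
        bij_betw (\<phi> U) (la_sections A U) (la_sections B U) \<and>
        (\<forall>V s. open V \<and> V \<subseteq> U \<and> s \<in> la_sections A U \<longrightarrow>
           \<phi> V (la_restrict A U V s) = la_restrict B U V (\<phi> U s)) \<and>
        (\<forall>s\<in>la_sections A U. \<forall>t\<in>la_sections A U.
           \<phi> U (la_add A U s t) = la_add B U (\<phi> U s) (\<phi> U t)) \<and>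
        (\<forall>f\<in>holo_functions U. \<forall>s\<in>la_sections A U.
           \<phi> U (la_smult A U f s) = la_smult B U f (\<phi> U s)) \<and>
        (\<forall>s\<in>la_sections A U. \<forall>t\<in>la_sections A U.
           \<phi> U (la_bracket A U s t) = la_bracket B U (\<phi> U s) (\<phi> U t)) \<and>
        (\<forall>s\<in>la_sections A U. la_anchor B U (\<phi> U s) = la_anchor A U s))"

definition lie_algebroid_isomorphic :: "'s lie_algebroid \<Rightarrow> 't lie_algebroid \<Rightarrow> bool" where
  "lie_algebroid_isomorphic A B \<longleftrightarrow> (\<exists>\<phi>. lie_algebroid_iso A B \<phi>)"


section \<open>The logarithmic tangent bundle\<close>

definition vanishing_ideal :: "cspace set \<Rightarrow> cspace set \<Rightarrow> (cspace \<Rightarrow> complex) set" where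
  "vanishing_ideal D U = {f \<in> holo_functions U. \<forall>p\<in>U \<inter> D. f p = 0}"

text \<open>Preservation of the ideal is a condition on ideal sheaves, hence the quantification over all
  open \<open>V \<subseteq> U\<close>.\<close>

definition log_vector_fields :: "cspace set \<Rightarrow> cspace set \<Rightarrow> (cspace \<Rightarrow> cspace) set" where
  "log_vector_fields D U =
     {X \<in> holo_vector_fields U.
        \<forall>V. open V \<and> V \<subseteq> U \<longrightarrow>
          (\<forall>f\<in>vanishing_ideal D V. restrict (vf_apply X f) V \<in> vanishing_ideal D V)}"

definition log_tangent :: "cspace set \<Rightarrow> (cspace \<Rightarrow> cspace) lie_algebroid" where
  "log_tangent D =
     \<lparr> la_sections = log_vector_fields D,
       la_restrict = (\<lambda>U V X. restrict X V),
       la_add = (\<lambda>U X Y. \<lambda>p\<in>U. X p + Y p),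
       la_smult = (\<lambda>U f X. \<lambda>p\<in>U. f p *s X p),
       la_bracket = (\<lambda>U X Y. restrict (vf_bracket X Y) U),
       la_anchor = (\<lambda>U X. X) \<rparr>"


section \<open>Action algebroids\<close>

locale complex_lie_algebra = vector_space smul
  for smul :: "complex \<Rightarrow> 'g::ab_group_add \<Rightarrow> 'g" +
  fixes br :: "'g \<Rightarrow> 'g \<Rightarrow> 'g"
  assumes finite_dim: "\<exists>B. finite B \<and> span B = UNIV"
    and br_linear_left: "Vector_Spaces.linear smul smul (\<lambda>a. br a b)"
    and br_linear_right: "Vector_Spaces.linear smul smul (\<lambda>b. br a b)"
    and br_alternating: "br a a = 0"
    and br_jacobi: "br a (br b c) + br b (br c a) + br c (br a b) = 0"

text \<open>A Lie algebra homomorphism \<open>\<rho>\<close> to the global holomorphic vector fields.\<close>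

definition infinitesimal_action ::
  "(complex \<Rightarrow> 'g::ab_group_add \<Rightarrow> 'g) \<Rightarrow> ('g \<Rightarrow> 'g \<Rightarrow> 'g) \<Rightarrow> ('g \<Rightarrow> cspace \<Rightarrow> cspace) \<Rightarrow> bool" where
  "infinitesimal_action smul br \<rho> \<longleftrightarrow>
     (\<forall>a. \<rho> a \<in> holo_vector_fields UNIV) \<and>
     (\<forall>p. Vector_Spaces.linear smul (*s) (\<lambda>a. \<rho> a p)) \<and>
     (\<forall>a b. \<rho> (br a b) = vf_bracket (\<rho> a) (\<rho> b))"

text \<open>As the type \<open>'g\<close> carries no topology, holomorphy and derivatives of maps with values in the
  finite-dimensional space \<open>'g\<close> are defined by composing with all linear functionals.\<close>

definition holo_maps ::
  "(complex \<Rightarrow> 'g::ab_group_add \<Rightarrow> 'g) \<Rightarrow> cspace set \<Rightarrow> (cspace \<Rightarrow> 'g) set" where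
  "holo_maps smul U =
     {s \<in> extensional U. \<forall>l. Vector_Spaces.linear smul (*) l \<longrightarrow> holo_on U (\<lambda>p. l (s p))}"

definition vf_apply_map ::
  "(complex \<Rightarrow> 'g::ab_group_add \<Rightarrow> 'g) \<Rightarrow> (cspace \<Rightarrow> cspace) \<Rightarrow> (cspace \<Rightarrow> 'g) \<Rightarrow> cspace \<Rightarrow> 'g" where
  "vf_apply_map smul X s p =
     (THE w. \<forall>l. Vector_Spaces.linear smul (*) l \<longrightarrow> l w = vf_apply X (\<lambda>q. l (s q)) p)"

definition action_anchor ::
  "('g \<Rightarrow> cspace \<Rightarrow> cspace) \<Rightarrow> cspace set \<Rightarrow> (cspace \<Rightarrow> 'g) \<Rightarrow> cspace \<Rightarrow> cspace" where
  "action_anchor \<rho> U s = (\<lambda>p\<in>U. \<rho> (s p) p)"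

text \<open>The bracket of sections is the unique extension by the Leibniz rule of the bracket of \<open>'g\<close> on
  constant sections.\<close>

definition action_algebroid ::
  "(complex \<Rightarrow> 'g::ab_group_add \<Rightarrow> 'g) \<Rightarrow> ('g \<Rightarrow> 'g \<Rightarrow> 'g) \<Rightarrow> ('g \<Rightarrow> cspace \<Rightarrow> cspace)
     \<Rightarrow> (cspace \<Rightarrow> 'g) lie_algebroid" where
  "action_algebroid smul br \<rho> =
     \<lparr> la_sections = holo_maps smul,
       la_restrict = (\<lambda>U V s. restrict s V),
       la_add = (\<lambda>U s t. \<lambda>p\<in>U. s p + t p),
       la_smult = (\<lambda>U f s. \<lambda>p\<in>U. smul (f p) (s p)),
       la_bracket = (\<lambda>U s t. \<lambda>p\<in>U.
          br (s p) (t p) + vf_apply_map smul (action_anchor \<rho> U s) t p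
                         - vf_apply_map smul (action_anchor \<rho> U t) s p),
       la_anchor = action_anchor \<rho> \<rparr>"


section \<open>The divisor\<close>

definition F_B5 :: "cspace \<Rightarrow> complex" where
  "F_B5 p = p $ 1 * (p $ 2) ^ 4 + (p $ 2) ^ 3 * p $ 3 + (p $ 3) ^ 3"

definition D_B5 :: "cspace set" where
  "D_B5 = {p. F_B5 p = 0}"

end

theory Submission
  imports Defs "HOL-Complex_Analysis.Cauchy_Integral_Formula"
begin

text \<open>Let \<open>s\<^sub>X\<close> denote the \<open>\<gg>\<close>-valued function corresponding to a logarithmic field \<open>X\<close>. All logarithmic
  fields vanish at the origin, so evaluating brackets there identifies \<open>\<gg>\<close> with the isotropy algebra, which has
  basis \<open>e\<close>, \<open>v\<close>, \<open>w\<close> with \<open>[e, v] = v\<close>, \<open>[e, w] = 2w\<close>, \<open>[v, w] = 0\<close>. The relation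
  \<open>[V, W] = 24zE + 6yV - 40xW\<close> becomes a first-order equation for \<open>s\<^sub>E\<close>, \<open>s\<^sub>V\<close>, \<open>s\<^sub>W\<close>. On the \<open>x\<close>-axis, where
  \<open>V\<close> and \<open>W\<close> vanish, it forces the \<open>e\<close>-component of \<open>s\<^sub>V\<close> to be \<open>-20x\<close> and the \<open>v\<close>-component of
  \<open>s\<^sub>W\<close> to be zero. The \<open>y\<close>-derivative at the origin of the equation's \<open>v\<close>-component shows that the
  \<open>e\<close>-component of \<open>s\<^sub>W\<close> has \<open>y\<close>-derivative \<open>-6\<close>, and the \<open>z\<close>-derivative of the
  equation's \<open>e\<close>-component then reads \<open>24 = 2 (-6) - 3 (-20)\<close>, which is absurd.\<close>


section \<open>Holomorphic functions of several variables\<close>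

lemma holo_onI:
  "(\<And>p. p \<in> U \<Longrightarrow> (f has_derivative F p) (at p)) \<Longrightarrow> (\<And>p c v. p \<in> U \<Longrightarrow> F p (c *s v) = c * F p v)
    \<Longrightarrow> holo_on U f"
  unfolding holo_on_def by blast

lemma holo_on_deriv:
  assumes "holo_on U f" "p \<in> U"
  shows "(f has_derivative frechet_derivative f (at p)) (at p)"
    and "frechet_derivative f (at p) (c *s v) = c * frechet_derivative f (at p) v"
proof -
  obtain f' where f': "(f has_derivative f') (at p)" "\<And>c v. f' (c *s v) = c * f' v"
    using assms unfolding holo_on_def by blast
  have "f' = frechet_derivative f (at p)"
    using f'(1) by (rule frechet_derivative_at)
  with f' show "(f has_derivative frechet_derivative f (at p)) (at p)"
    "frechet_derivative f (at p) (c *s v) = c * frechet_derivative f (at p) v"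
    by auto
qed

lemma holo_on_subset: "holo_on U f \<Longrightarrow> V \<subseteq> U \<Longrightarrow> holo_on V f"
  unfolding holo_on_def by blast

lemma holo_on_const: "holo_on U (\<lambda>p. c)"
  by (rule holo_onI[where F = "\<lambda>p h. 0"]) auto

lemma holo_on_coord: "holo_on U (\<lambda>p. p $ i)"
  by (rule holo_onI[where F = "\<lambda>p h. h $ i"])
    (auto intro!: derivative_eq_intros bounded_linear.has_derivative[OF bounded_linear_vec_nth])

lemma holo_on_add: "holo_on U f \<Longrightarrow> holo_on U g \<Longrightarrow> holo_on U (\<lambda>p. f p + g p)"
  by (rule holo_onI[where F = "\<lambda>p h. frechet_derivative f (at p) h + frechet_derivative g (at p) h"])
    (auto intro!: derivative_eq_intros dest: holo_on_deriv simp: holo_on_deriv(2) distrib_left)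

lemma holo_on_mult: "holo_on U f \<Longrightarrow> holo_on U g \<Longrightarrow> holo_on U (\<lambda>p. f p * g p)"
  by (rule holo_onI[where F = "\<lambda>p h. f p * frechet_derivative g (at p) h + frechet_derivative f (at p) h * g p"])
    (auto intro!: derivative_eq_intros dest: holo_on_deriv simp: holo_on_deriv(2) algebra_simps)

lemma holo_on_uminus: "holo_on U f \<Longrightarrow> holo_on U (\<lambda>p. - f p)"
  using holo_on_mult[OF holo_on_const[of U "- 1"], of f] by simp

lemma holo_on_diff: "holo_on U f \<Longrightarrow> holo_on U g \<Longrightarrow> holo_on U (\<lambda>p. f p - g p)"
  using holo_on_add[OF _ holo_on_uminus, of U f g] by simp

lemma holo_on_sum: "(\<And>i. i \<in> I \<Longrightarrow> holo_on U (f i)) \<Longrightarrow> holo_on U (\<lambda>p. \<Sum>i\<in>I. f i p)"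
  by (induction I rule: infinite_finite_induct) (auto intro: holo_on_const holo_on_add)

lemma holo_on_power: "holo_on U f \<Longrightarrow> holo_on U (\<lambda>p. f p ^ n)"
  by (induction n) (auto intro: holo_on_const holo_on_mult)

lemmas holo_on_intros =
  holo_on_const holo_on_coord holo_on_add holo_on_mult holo_on_uminus holo_on_diff holo_on_power

lemma holo_on_cong:
  assumes "open U" "\<And>p. p \<in> U \<Longrightarrow> f p = g p" "holo_on U f"
  shows "holo_on U g"
proof (rule holo_onI)
  fix p assume p: "p \<in> U"
  show "(g has_derivative frechet_derivative f (at p)) (at p)"
    using has_derivative_transform_within_open[OF holo_on_deriv(1)[OF assms(3) p] assms(1) p] assms(2)
    by auto
qed (auto simp: holo_on_deriv(2)[OF assms(3)])

lemma holo_on_continuous_on: "holo_on U f \<Longrightarrow> continuous_on U f"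
  by (metis continuous_at_imp_continuous_on has_derivative_continuous holo_on_deriv(1))

section \<open>Partial derivatives through Cauchy's formula\<close>

definition pd :: "3 \<Rightarrow> (cspace \<Rightarrow> complex) \<Rightarrow> cspace \<Rightarrow> complex" where
  "pd i f p = frechet_derivative f (at p) (axis i 1)"

lemma cspace_expand: "v = (\<Sum>i\<in>UNIV. v $ i *s axis i (1::complex))" for v :: cspace
  by (simp add: vec_eq_iff axis_def if_distrib[of "\<lambda>x. _ * x"] cong: if_cong)

lemma frechet_eq_pd:
  assumes "holo_on U f" "p \<in> U"
  shows "frechet_derivative f (at p) v = (\<Sum>i\<in>UNIV. v $ i * pd i f p)"
proof -
  interpret bounded_linear "frechet_derivative f (at p)"
    using holo_on_deriv(1)[OF assms] by (rule has_derivative_bounded_linear)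
  have "frechet_derivative f (at p) v = frechet_derivative f (at p) (\<Sum>i\<in>UNIV. v $ i *s axis i 1)"
    by (subst cspace_expand) simp
  also have "\<dots> = (\<Sum>i\<in>UNIV. v $ i * pd i f p)"
    by (simp only: sum holo_on_deriv(2)[OF assms] pd_def)
  finally show ?thesis .
qed

lemma has_derivative_pd:
  assumes "holo_on U f" "p \<in> U"
  shows "(f has_derivative (\<lambda>h. \<Sum>i\<in>UNIV. h $ i * pd i f p)) (at p)"
  using holo_on_deriv(1)[OF assms] frechet_eq_pd[OF assms]
  by (metis (no_types, lifting) ext)

text \<open>This is \<open>circlepath 0 r\<close> written out, so that a contour integral becomes an
  integral over the fixed interval from 0 to 1.\<close>

definition circ :: "real \<Rightarrow> real \<Rightarrow> complex" where
  "circ r t = of_real r * exp (2 * of_real pi * \<i> * of_real t)"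

lemma circ_norm: "r > 0 \<Longrightarrow> norm (circ r t) = r"
  by (simp add: circ_def norm_mult)

lemma circ_continuous [continuous_intros]:
  "continuous_on S f \<Longrightarrow> continuous_on S (\<lambda>x. circ r (f x))"
  unfolding circ_def by (intro continuous_intros)

lemma bounded_linear_smult_vec: "bounded_linear (\<lambda>z. z *s (v :: cspace))"
  unfolding linear_conv_bounded_linear[symmetric]
  by (rule linearI) (auto simp: vec_eq_iff algebra_simps)

lemma vec_smult_derivative [derivative_intros]:
  "((\<lambda>z. p + z *s (v :: cspace)) has_derivative (\<lambda>h. h *s v)) (at z)"
  using has_derivative_add[OF has_derivative_const
      bounded_linear_imp_has_derivative[OF bounded_linear_smult_vec]] by fastforce

text \<open>Cauchy's formula for the derivative at \<open>0\<close> of the one-variable function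
  \<open>g z = f (p + z *s axis i 1)\<close>. The velocity of the circle cancels one of the two
  factors \<open>circ r t\<close> in the denominator.\<close>

lemma pd_cauchy:
  assumes f: "holo_on U f" and r: "r > 0"
    and sub: "\<And>z. z \<in> cball 0 r \<Longrightarrow> p + z *s axis i 1 \<in> U"
  shows "pd i f p = integral (cbox 0 1) (\<lambda>t. f (p + circ r t *s axis i 1) / circ r t)"
proof -
  define g where "g z = f (p + z *s axis i 1)" for z
  have g': "(g has_field_derivative pd i f (p + z *s axis i 1)) (at z)" if "z \<in> cball 0 r" for z
  proof -
    have "(g has_derivative (\<lambda>h. frechet_derivative f (at (p + z *s axis i 1)) (h *s axis i 1))) (at z)"
      unfolding g_def
      by (rule has_derivative_compose[OF vec_smult_derivative holo_on_deriv(1)[OF f sub[OF that]]])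
    then show ?thesis
      unfolding has_field_derivative_def pd_def holo_on_deriv(2)[OF f sub[OF that]]
      by (rule has_derivative_eq_rhs) (simp add: fun_eq_iff)
  qed
  have "continuous_on (cball 0 r) g"
    using g' by (meson DERIV_continuous continuous_at_imp_continuous_on)
  moreover have "g holomorphic_on ball 0 r"
    using g' by (meson ball_subset_cball field_differentiable_at_within field_differentiable_def holomorphic_onI subsetD)
  ultimately have "contour_integral (circlepath 0 r) (\<lambda>u. g u / (u - 0)^2) = 2 * pi * \<i> * deriv g 0"
    using r by (intro Cauchy_contour_integral_circlepath_2) auto
  moreover have "deriv g 0 = pd i f p"
    using g'[of 0] r by (simp add: DERIV_imp_deriv)
  moreover have "contour_integral (circlepath 0 r) (\<lambda>u. g u / (u - 0)^2)
      = integral {0..1} (\<lambda>t. 2 * pi * \<i> * (g (circ r t) / circ r t))"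
  proof -
    have "circlepath 0 r t = circ r t"
      "vector_derivative (circlepath 0 r) (at t) = 2 * pi * \<i> * circ r t" for t
      by (simp add: circlepath circ_def, simp add: vector_derivative_circlepath circ_def)
    moreover have "circ r t \<noteq> 0" for t
      using r by (simp add: circ_def)
    ultimately show ?thesis
      unfolding contour_integral_integral by (simp add: power2_eq_square mult_ac)
  qed
  ultimately have "2 * pi * \<i> * pd i f p = 2 * pi * \<i> * integral {0..1} (\<lambda>t. g (circ r t) / circ r t)"
    by (simp only: integral_mult_right)
  then show ?thesis
    by (simp add: g_def)
qed


text \<open>Allows Cauchy's formula to be used with one radius \<open>r\<close> for all centres in
  \<open>ball p0 r\<close>.\<close>

lemma circ_ball:
  fixes p p0 :: cspace
  assumes "p \<in> ball p0 r" "r > 0" "z \<in> cball 0 r"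
  shows "p + z *s axis i 1 \<in> ball p0 (2 * r)"
proof -
  have "norm (z *s axis i 1 :: cspace) = norm z"
    by (simp add: norm_vec_def L2_set_def axis_def if_distrib[of "\<lambda>x. _ * x"] if_distrib[of norm]
        if_distrib[of "\<lambda>x. x ^ 2"] cong: if_cong)
  then have "norm (p + z *s axis i 1 - p0) < 2 * r"
    using assms norm_triangle_ineq[of "p - p0" "z *s axis i 1"]
    by (simp add: dist_norm norm_minus_commute algebra_simps)
  then show ?thesis
    by (simp add: dist_norm norm_minus_commute)
qed

lemma shift_continuous:
  fixes p0 :: cspace
  assumes "continuous_on (ball p0 (2 * r)) h" "r > 0"
  shows "continuous_on (ball p0 r \<times> cbox 0 1) (\<lambda>(p, t). h (p + circ r t *s axis i 1) / circ r t)"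
proof -
  note c = bounded_linear.continuous_on[OF bounded_linear_smult_vec]
  have "continuous_on (ball p0 r \<times> cbox 0 1) (\<lambda>x. h (fst x + circ r (snd x) *s axis i 1) / circ r (snd x))"
  proof (intro continuous_intros c continuous_on_compose2[OF assms(1)])
    show "(\<lambda>x. fst x + circ r (snd x) *s axis i 1) ` (ball p0 r \<times> cbox 0 1) \<subseteq> ball p0 (2 * r)"
      using circ_ball[OF _ assms(2)] circ_norm[OF assms(2)] by (force simp del: mem_ball)
    show "\<forall>x\<in>ball p0 r \<times> cbox 0 1. circ r (snd x) \<noteq> 0"
      using assms(2) by (simp add: circ_def)
  qed
  then show ?thesis
    by (simp add: case_prod_unfold)
qed

text \<open>\<open>holo_on\<close> asks for no continuity of the derivative; it follows because
  Cauchy's formula makes \<open>pd i f\<close> a parameter integral with a jointly continuous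
  integrand.\<close>

lemma pd_continuous:
  assumes "holo_on (ball p0 (2 * r)) f" "r > 0"
  shows "continuous_on (ball p0 r) (pd i f)"
proof -
  have "continuous_on (ball p0 r) (\<lambda>p. integral (cbox 0 1) (\<lambda>t. f (p + circ r t *s axis i 1) / circ r t))"
    using integral_continuous_on_param[OF shift_continuous[OF holo_on_continuous_on[OF assms(1)] assms(2)]] .
  then show ?thesis
    using pd_cauchy[OF assms circ_ball[OF _ assms(2)]]
    by (subst continuous_on_cong[OF refl]) auto
qed

text \<open>Cauchy's formula in the \<open>i\<close>-th variable expresses \<open>pd i f\<close> as an integral over a circle,
  which may be differentiated under the integral sign because the partial derivatives of \<open>f\<close> are
  continuous.\<close>

lemma holo_on_pd_ball:
  assumes f: "holo_on (ball p0 (4 * r)) f" and r: "r > 0"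
  shows "holo_on (ball p0 r) (pd i f)"
proof -
  define G where "G p = (\<lambda>h. \<Sum>j\<in>UNIV. h $ j * pd j f p)" for p
  have G: "(f has_derivative G p) (at p)" if "p \<in> ball p0 (4 * r)" for p
    using has_derivative_pd[OF f that] by (simp add: G_def)
  have f2: "holo_on (ball p0 (2 * r)) f"
    using r by (intro holo_on_subset[OF f] subset_ball) simp
  \<comment> \<open>The Leibniz rule takes the derivative of the integrand as a continuous family of
    bounded linear operators.\<close>
  define L where "L p t = Blinfun (\<lambda>h. G (p + circ r t *s axis i 1) h / circ r t)" for p t
  have L: "blinfun_apply (L p t) = (\<lambda>h. G (p + circ r t *s axis i 1) h / circ r t)"
    if "p \<in> ball p0 r" for p t
  proof -
    have "p + circ r t *s axis i 1 \<in> ball p0 (4 * r)"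
      using circ_ball[OF that r, of "circ r t" i] circ_norm[OF r, of t] r by auto
    then have "bounded_linear (G (p + circ r t *s axis i 1))"
      using G has_derivative_bounded_linear by blast
    then show ?thesis
      unfolding L_def by (intro bounded_linear_Blinfun_apply bounded_linear_compose[OF bounded_linear_divide])
  qed
  have int: "(\<lambda>t. h (p + circ r t *s axis i 1) / circ r t) integrable_on cbox 0 1"
    if "continuous_on (ball p0 (2 * r)) h" "p \<in> ball p0 r" for h p
  proof (rule integrable_continuous)
    have "continuous_on (cbox 0 1) ((\<lambda>(p, t). h (p + circ r t *s axis i 1) / circ r t) \<circ> (\<lambda>t. (p, t)))"
      by (rule continuous_on_compose) (use that in \<open>auto intro!: continuous_intros
          continuous_on_subset[OF shift_continuous[OF that(1) r]]\<close>)
    then show "continuous_on (cbox 0 1) (\<lambda>t. h (p + circ r t *s axis i 1) / circ r t)"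
      by (simp add: o_def)
  qed
  \<comment> \<open>\<open>pd_continuous\<close> halves the radius: continuity on the ball of radius
    \<open>2 * r\<close>, which contains all Cauchy circles, uses that \<open>f\<close> is
    holomorphic on the ball of radius \<open>4 * r\<close>.\<close>
  have Gc: "continuous_on (ball p0 (2 * r)) (\<lambda>p. G p h)" for h
    unfolding G_def using pd_continuous[of p0 "2 * r" f] f r
    by (auto intro!: continuous_intros)
  have cL: "continuous_on (ball p0 r \<times> cbox 0 1) (\<lambda>(p, t). L p t)"
  proof (rule continuous_on_blinfun_componentwise)
    fix h :: cspace
    show "continuous_on (ball p0 r \<times> cbox 0 1) (\<lambda>x. blinfun_apply (case x of (p, t) \<Rightarrow> L p t) h)"
      by (rule continuous_on_eq[OF shift_continuous[OF Gc[of h] r, of i]]) (auto simp: L)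
  qed
  define I where "I p = integral (cbox 0 1) (L p)" for p
  have I_apply: "blinfun_apply (I p) h = integral (cbox 0 1) (\<lambda>t. G (p + circ r t *s axis i 1) h / circ r t)"
    if "p \<in> ball p0 r" for p h
  proof -
    have "continuous_on (cbox 0 1) ((\<lambda>(p, t). L p t) \<circ> (\<lambda>t. (p, t)))"
      by (rule continuous_on_compose) (use that in \<open>auto intro!: continuous_intros
          continuous_on_subset[OF cL]\<close>)
    then have "L p integrable_on cbox 0 1"
      by (intro integrable_continuous) (simp add: o_def)
    then show ?thesis
      unfolding I_def by (simp add: blinfun_apply_integral L[OF that])
  qed
  show ?thesis
  proof (rule holo_onI)
    fix p assume p: "p \<in> ball p0 r"
    have "((\<lambda>p. integral (cbox 0 1) (\<lambda>t. f (p + circ r t *s axis i 1) / circ r t))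
        has_derivative blinfun_apply (integral (cbox 0 1) (L p))) (at p within ball p0 r)"
    proof (rule leibniz_rule[OF _ int[OF holo_on_continuous_on[OF f2]] cL p])
      fix q :: cspace and t :: real assume q: "q \<in> ball p0 r"
      have "((\<lambda>q. q + circ r t *s axis i 1) has_derivative (\<lambda>h. h)) (at q)"
        by (auto intro!: derivative_eq_intros)
      moreover have "q + circ r t *s axis i 1 \<in> ball p0 (4 * r)"
        using circ_ball[OF q r, of "circ r t" i] circ_norm[OF r, of t] r by auto
      ultimately have "((\<lambda>q. f (q + circ r t *s axis i 1)) has_derivative G (q + circ r t *s axis i 1)) (at q)"
        using has_derivative_compose[of "\<lambda>q. q + circ r t *s axis i 1" "\<lambda>h. h" q UNIV f] G by auto
      then have "((\<lambda>q. f (q + circ r t *s axis i 1) / circ r t) has_derivative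
          (\<lambda>h. G (q + circ r t *s axis i 1) h / circ r t)) (at q)"
        by (rule bounded_linear.has_derivative[OF bounded_linear_divide])
      then show "((\<lambda>q. f (q + circ r t *s axis i 1) / circ r t) has_derivative blinfun_apply (L q t))
          (at q within ball p0 r)"
        by (simp add: L[OF q] has_derivative_at_withinI)
    qed auto
    then have "((\<lambda>p. integral (cbox 0 1) (\<lambda>t. f (p + circ r t *s axis i 1) / circ r t))
        has_derivative blinfun_apply (I p)) (at p)"
      using p at_within_open[OF p open_ball] by (simp add: I_def)
    then show "(pd i f has_derivative blinfun_apply (I p)) (at p)"
      by (rule has_derivative_transform_within_open[OF _ open_ball p])
        (rule pd_cauchy[OF f2 r circ_ball[OF _ r], symmetric])
    show "blinfun_apply (I p) (c *s v) = c * blinfun_apply (I p) v" for c v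
    proof -
      have "G q (c *s v) = c * G q v" for q
        by (simp add: G_def sum_distrib_left mult_ac)
      then have "blinfun_apply (I p) (c *s v)
          = integral (cbox 0 1) (\<lambda>t. c * (G (p + circ r t *s axis i 1) v / circ r t))"
        by (simp add: I_apply[OF p])
      then show ?thesis
        by (simp only: integral_mult_right I_apply[OF p])
    qed
  qed
qed

text \<open>Keeps \<open>vf_apply X f\<close> holomorphic, and later makes first derivatives of
  section components differentiable at the origin.\<close>

lemma holo_on_pd:
  assumes "open U" "holo_on U f"
  shows "holo_on U (pd i f)"
proof -
  have "\<exists>f'. (pd i f has_derivative f') (at p) \<and> (\<forall>c v. f' (c *s v) = c * f' v)" if p: "p \<in> U" for p
  proof -
    obtain e where e: "e > 0" "ball p e \<subseteq> U"
      using openE[OF assms(1) p] by metis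
    have "holo_on (ball p (e / 4)) (pd i f)"
      by (rule holo_on_pd_ball) (use e in \<open>simp_all add: holo_on_subset[OF assms(2)]\<close>)
    then show ?thesis
      using e(1) unfolding holo_on_def by simp
  qed
  then show ?thesis
    unfolding holo_on_def by blast
qed

lemma holo_on_vf_apply:
  assumes "open U" "holo_on U f" "\<And>i. holo_on U (\<lambda>p. X p $ i)"
  shows "holo_on U (vf_apply X f)"
proof (rule holo_on_cong[OF assms(1)])
  show "holo_on U (\<lambda>p. \<Sum>i\<in>UNIV. X p $ i * pd i f p)"
    by (intro holo_on_sum holo_on_mult assms(3) holo_on_pd assms(1,2))
qed (simp add: vf_apply_def frechet_eq_pd[OF assms(2)])

lemma holo_on_chain:
  assumes f: "holo_on U f" and "g s \<in> U"
    and g: "\<And>i. ((\<lambda>s. g s $ i) has_field_derivative v $ i) (at s)"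
  shows "((\<lambda>s. f (g s)) has_field_derivative frechet_derivative f (at (g s)) v) (at s)"
proof -
  have "((\<lambda>s. \<Sum>i\<in>UNIV. g s $ i *s axis i 1) has_derivative (\<lambda>h. \<Sum>i\<in>UNIV. (h * v $ i) *s axis i 1)) (at s)"
  proof (rule has_derivative_sum)
    fix i :: 3
    show "((\<lambda>s. g s $ i *s axis i (1::complex)) has_derivative (\<lambda>h. (h * v $ i) *s axis i 1)) (at s)"
      using bounded_linear.has_derivative[OF bounded_linear_smult_vec g[of i, unfolded has_field_derivative_def]]
      by (simp add: mult.commute)
  qed
  moreover have "(\<Sum>i\<in>UNIV. (h * v $ i) *s axis i 1) = h *s v" for h
    by (subst (2) cspace_expand) (simp add: vec_eq_iff sum_distrib_left mult_ac)
  ultimately have "(g has_derivative (\<lambda>h. h *s v)) (at s)"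
    using cspace_expand by simp
  then have "((\<lambda>s. f (g s)) has_derivative (\<lambda>h. frechet_derivative f (at (g s)) (h *s v))) (at s)"
    using holo_on_deriv(1)[OF f assms(2)] by (rule has_derivative_compose)
  then show ?thesis
    unfolding has_field_derivative_def
    by (rule has_derivative_eq_rhs) (simp add: fun_eq_iff holo_on_deriv(2)[OF f assms(2)])
qed

section \<open>Logarithmic fields of the divisor\<close>

lemma coord_has_derivative [derivative_intros]:
  "((\<lambda>p. p $ i) has_derivative (\<lambda>h. h $ i)) (at (p :: cspace))"
  by (rule bounded_linear_imp_has_derivative[OF bounded_linear_vec_nth])

lemma F_B5_has_derivative:
  "(F_B5 has_derivative (\<lambda>h. (p $ 2) ^ 4 * h $ 1 + (4 * p $ 1 * (p $ 2) ^ 3 + 3 * (p $ 2)\<^sup>2 * p $ 3) * h $ 2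
      + ((p $ 2) ^ 3 + 3 * (p $ 3)\<^sup>2) * h $ 3)) (at p)"
  unfolding F_B5_def [abs_def]
  by (auto intro!: derivative_eq_intros simp: fun_eq_iff algebra_simps power2_eq_square power3_eq_cube)

lemma frechet_F_B5:
  "frechet_derivative F_B5 (at p) v = (p $ 2) ^ 4 * v $ 1
      + (4 * p $ 1 * (p $ 2) ^ 3 + 3 * (p $ 2)\<^sup>2 * p $ 3) * v $ 2 + ((p $ 2) ^ 3 + 3 * (p $ 3)\<^sup>2) * v $ 3"
  using frechet_derivative_at[OF F_B5_has_derivative, of p] by (metis (no_types, lifting))

text \<open>Continuity of \<open>g\<close> at \<open>0\<close> keeps the curve inside
  \<open>U\<close> for small parameters, so \<open>f (g s)\<close> is zero near \<open>0\<close>,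
  and the chain rule identifies its derivative.\<close>

lemma deriv_zero_along_curve:
  assumes f: "holo_on U f" and "open U" and g0: "g 0 \<in> U"
    and g: "\<And>i. ((\<lambda>s. g s $ i) has_field_derivative v $ i) (at 0)"
    and zero: "\<And>s. g s \<in> U \<Longrightarrow> f (g s) = 0"
  shows "frechet_derivative f (at (g 0)) v = 0"
proof -
  have "(g \<longlongrightarrow> g 0) (nhds 0)"
  proof (rule vec_tendstoI)
    fix i
    have "isCont (\<lambda>s. g s $ i) 0"
      using g by (rule DERIV_isCont)
    then show "((\<lambda>s. g s $ i) \<longlongrightarrow> g 0 $ i) (nhds 0)"
      using tendsto_at_iff_tendsto_nhds[of "\<lambda>s. g s $ i" 0] by (simp add: isCont_def)
  qed
  then have "\<forall>\<^sub>F s in nhds 0. g s \<in> U"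
    using assms(2) g0 by (rule topological_tendstoD)
  then have "\<forall>\<^sub>F s in nhds 0. f (g s) = 0"
    by eventually_elim (rule zero)
  then have "((\<lambda>s. f (g s)) has_field_derivative 0) (at 0)"
    by (subst DERIV_cong_ev[OF refl _ refl, where g = "\<lambda>_. 0"]) auto
  with holo_on_chain[OF f g0 g] show ?thesis
    by (rule DERIV_unique)
qed

text \<open>Away from the \<open>x\<close>-axis the divisor is the graph of a function of \<open>(y, z)\<close>, so a field tangent
  to that graph and to the axis kills every function vanishing on the divisor.\<close>

lemma log_vector_fieldI:
  assumes X: "\<And>i. holo_on UNIV (\<lambda>p. X p $ i)"
    and graph: "\<And>p. p $ 2 \<noteq> 0 \<Longrightarrow> F_B5 p = 0 \<Longrightarrow> frechet_derivative F_B5 (at p) (X p) = 0"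
    and axis: "\<And>p. p $ 2 = 0 \<Longrightarrow> p $ 3 = 0 \<Longrightarrow> X p $ 2 = 0 \<and> X p $ 3 = 0"
  shows "X \<in> log_vector_fields D_B5 UNIV"
proof -
  have "restrict (vf_apply X f) U \<in> vanishing_ideal D_B5 U"
    if U: "open U" and f: "f \<in> vanishing_ideal D_B5 U" for U f
  proof -
    have hf: "holo_on U f" and f0: "\<And>p. p \<in> U \<Longrightarrow> F_B5 p = 0 \<Longrightarrow> f p = 0"
      using f by (auto simp: vanishing_ideal_def holo_functions_def D_B5_def)
    have "frechet_derivative f (at p) (X p) = 0" if p: "p \<in> U" "F_B5 p = 0" for p
    proof (cases "p $ 2 = 0")
      case True
      with p have z: "p $ 3 = 0"
        by (simp add: F_B5_def)
      \<comment> \<open>The \<open>x\<close>-axis lies in the divisor, and by the assumption on the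
        axis \<open>X p\<close> is tangent to it.\<close>
      define g where "g s = (vector [p $ 1 + s * X p $ 1, 0, 0] :: cspace)" for s
      have g0: "g 0 = p"
        using True z by (simp add: g_def vec_eq_iff forall_3)
      have "((\<lambda>s. g s $ i) has_field_derivative X p $ i) (at 0)" for i
        using exhaust_3[of i] axis[OF True z]
        by (auto simp: g_def intro!: derivative_eq_intros)
      moreover have "f (g s) = 0" if "g s \<in> U" for s
        using f0[OF that] by (simp add: g_def F_B5_def)
      ultimately show ?thesis
        using deriv_zero_along_curve[OF hf U, of g "X p"] p g0 by simp
    next
      case False
      define b where "b = X p $ 2"
      define c where "c = X p $ 3"
      \<comment> \<open>Solves \<open>F_B5 = 0\<close> for the first coordinate.\<close>
      define x where "x = (\<lambda>y z :: complex. - (z / y) - z ^ 3 / y ^ 4)"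
      define g where "g s = (vector [x (p $ 2 + s * b) (p $ 3 + s * c), p $ 2 + s * b, p $ 3 + s * c] :: cspace)" for s
      have graph_eq: "x y z * y ^ 4 + y ^ 3 * z + z ^ 3 = 0" if "y \<noteq> 0" for y z
        using that by (simp add: x_def field_simps power_numeral_reduce)
      have "(p $ 2) ^ 4 * (p $ 1 - x (p $ 2) (p $ 3)) = 0"
        using False p(2) unfolding x_def F_B5_def
        by (simp add: field_simps power_numeral_reduce)
      then have px: "p $ 1 = x (p $ 2) (p $ 3)"
        using False by simp
      then have g0: "g 0 = p"
        by (simp add: g_def vec_eq_iff forall_3)
      \<comment> \<open>\<open>A\<close> is the derivative of the graph function \<open>x\<close>
        along \<open>(b, c)\<close>; with \<open>t\<close> split off, \<open>y^4\<close> is a common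
        denominator of its terms.\<close>
      define t where "t = (p $ 3) ^ 3 / p $ 2"
      define A where "A = - c / p $ 2 + p $ 3 * b / (p $ 2)\<^sup>2 - 3 * (p $ 3)\<^sup>2 * c / (p $ 2) ^ 4
        + 4 * t * b / (p $ 2) ^ 4"
      have "((\<lambda>s. g s $ 1) has_field_derivative A) (at 0)"
        unfolding g_def vector_3 x_def A_def t_def using False
        by (auto intro!: derivative_eq_intros simp: field_simps power_numeral_reduce)
      \<comment> \<open>The tangency condition determines the first component of \<open>X p\<close>
        from \<open>b\<close> and \<open>c\<close>, because its coefficient \<open>y^4\<close> is
        nonzero.\<close>
      moreover have "A = X p $ 1"
      proof -
        have "4 * p $ 1 * (p $ 2) ^ 3 = - 4 * p $ 3 * (p $ 2)\<^sup>2 - 4 * t"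
          using False by (simp add: px x_def t_def field_simps power_numeral_reduce)
        then have "(p $ 2) ^ 4 * X p $ 1
            = - c * (p $ 2) ^ 3 + p $ 3 * b * (p $ 2)\<^sup>2 - 3 * (p $ 3)\<^sup>2 * c + 4 * t * b"
          using graph[OF False p(2)] unfolding frechet_F_B5 b_def c_def by algebra
        moreover have "(p $ 2) ^ 4 * A
            = - c * (p $ 2) ^ 3 + p $ 3 * b * (p $ 2)\<^sup>2 - 3 * (p $ 3)\<^sup>2 * c + 4 * t * b"
          using False by (simp add: A_def field_simps power_numeral_reduce)
        ultimately have "(p $ 2) ^ 4 * A = (p $ 2) ^ 4 * X p $ 1"
          by (simp only:)
        then show ?thesis
          using False by simp
      qed
      ultimately have "((\<lambda>s. g s $ i) has_field_derivative X p $ i) (at 0)" for i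
        using exhaust_3[of i] b_def c_def
        by (auto simp: g_def intro!: derivative_eq_intros)
      \<comment> \<open>The graph equation is available only for nonzero \<open>y\<close>, so
        \<open>U\<close> is shrunk by this open condition.\<close>
      moreover have "f (g s) = 0" if "g s \<in> U \<inter> {q. q $ 2 \<noteq> 0}" for s
      proof (rule f0)
        from that have "p $ 2 + s * b \<noteq> 0"
          by (simp add: g_def)
        then show "F_B5 (g s) = 0"
          using graph_eq by (simp add: g_def F_B5_def)
      qed (use that in auto)
      moreover have "open (U \<inter> {q. q $ 2 \<noteq> 0})"
        using U by (intro open_Int open_Collect_neq continuous_intros)
      moreover have "holo_on (U \<inter> {q. q $ 2 \<noteq> 0}) f"
        using hf by (rule holo_on_subset) auto
      ultimately show ?thesis
        using deriv_zero_along_curve[of "U \<inter> {q. q $ 2 \<noteq> 0}" f g "X p"] p g0 False by simp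
    qed
    moreover have "holo_on U (vf_apply X f)"
      by (rule holo_on_vf_apply[OF U hf holo_on_subset[OF X]]) auto
    then have "holo_on U (restrict (vf_apply X f) U)"
      by (rule holo_on_cong[OF U, rotated]) auto
    ultimately show ?thesis
      by (auto simp: vanishing_ideal_def holo_functions_def D_B5_def vf_apply_def)
  qed
  then show ?thesis
    using X by (auto simp: log_vector_fields_def holo_vector_fields_def extensional_def)
qed

section \<open>Restriction to the \<open>x\<close>-axis and vanishing at the origin\<close>

definition axis_pt :: "complex \<Rightarrow> cspace" where
  "axis_pt x = vector [x, 0, 0]"

lemma axis_pt_nth [simp]: "axis_pt x $ 1 = x" "axis_pt x $ 2 = 0" "axis_pt x $ 3 = 0"
  by (simp_all add: axis_pt_def)

lemma axis_pt_0 [simp]: "axis_pt 0 = 0"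
  by (simp add: vec_eq_iff forall_3)

lemma axis_pt_smult: "h *s axis_pt x = axis_pt (h * x)"
  by (simp add: vec_eq_iff forall_3)

lemma holo_on_axis:
  assumes "holo_on UNIV f"
  shows "((\<lambda>s. f (axis_pt (c * s))) has_field_derivative frechet_derivative f (at (axis_pt (c * s))) (axis_pt c)) (at s)"
proof (rule holo_on_chain[OF assms UNIV_I])
  fix i
  show "((\<lambda>s. axis_pt (c * s) $ i) has_field_derivative axis_pt c $ i) (at s)"
    using exhaust_3[of i] by (auto intro!: derivative_eq_intros)
qed

text \<open>Extends to \<open>a\<close> an identity obtained by dividing by a factor that vanishes
  there.\<close>

lemma isCont_eq_zero:
  fixes h :: "complex \<Rightarrow> complex"
  assumes "(h has_field_derivative d) (at a)" "\<And>s. s \<noteq> a \<Longrightarrow> h s = 0"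
  shows "h a = 0"
proof -
  have "h \<midarrow>a\<rightarrow> h a"
    using DERIV_isCont[OF assms(1)] by (simp add: isCont_def)
  moreover have "h \<midarrow>a\<rightarrow> 0"
    by (rule Lim_transform_eventually[OF tendsto_const])
      (use assms(2) in \<open>auto simp: eventually_at_filter\<close>)
  ultimately show ?thesis
    by (rule LIM_unique)
qed

lemma frechet_axis_zero:
  assumes "holo_on UNIV f" "\<And>x. f (axis_pt x) = 0"
  shows "frechet_derivative f (at (axis_pt x)) (axis_pt c) = 0"
proof -
  have "frechet_derivative f (at (axis_pt (1 * x))) (axis_pt 1) = 0"
    by (rule DERIV_unique[OF holo_on_axis[OF assms(1)]]) (simp add: assms(2))
  then show ?thesis
    using holo_on_deriv(2)[OF assms(1), of "axis_pt x" c "axis_pt 1"] by (simp add: axis_pt_smult)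
qed

text \<open>The divisor contains the curves \<open>m \<mapsto> (-(m + 1) t, m\<^sup>3 t\<^sup>2, m\<^sup>4 t\<^sup>3)\<close>; the two
  leading terms at \<open>m = 0\<close> of the tangency condition kill the \<open>y\<close>- and \<open>z\<close>-components on the
  \<open>x\<close>-axis, and the curve \<open>m = -3\<close>, through the origin, kills the remaining one.\<close>

lemma log_vector_field_zero:
  assumes "X \<in> log_vector_fields D_B5 UNIV"
  shows "X 0 = 0"
proof -
  define P where "P m t = (vector [- (m + 1) * t, m ^ 3 * t\<^sup>2, m ^ 4 * t ^ 3] :: cspace)" for m t
  have X: "holo_on UNIV (\<lambda>p. X p $ i)" for i
    using assms by (simp add: log_vector_fields_def holo_vector_fields_def)
  have "holo_on UNIV F_B5"
    unfolding F_B5_def [abs_def] by (intro holo_on_intros)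
  then have F: "F_B5 \<in> vanishing_ideal D_B5 UNIV"
    by (simp add: vanishing_ideal_def holo_functions_def D_B5_def)
  have XF: "frechet_derivative F_B5 (at p) (X p) = 0" if "F_B5 p = 0" for p
  proof -
    have "restrict (vf_apply X F_B5) UNIV \<in> vanishing_ideal D_B5 UNIV"
      using assms F by (simp add: log_vector_fields_def)
    then show ?thesis
      using that by (simp add: vanishing_ideal_def D_B5_def vf_apply_def)
  qed
  \<comment> \<open>The gradient of \<open>F_B5\<close> at \<open>P m t\<close> has the common
    factor \<open>m^8 * t^6\<close>; this is the tangency condition after cancelling it.\<close>
  have tangent: "m ^ 4 * t\<^sup>2 * X (P m t) $ 1 - m * (4 + m) * t * X (P m t) $ 2 + (m + 3) * X (P m t) $ 3 = 0"
    (is "?g = 0") if "m \<noteq> 0" "t \<noteq> 0" for m t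
  proof -
    have "F_B5 (P m t) = 0"
      by (simp add: F_B5_def P_def power2_eq_square power_numeral_reduce algebra_simps)
    from XF[OF this] have "m ^ 8 * t ^ 6 * ?g = 0"
      unfolding frechet_F_B5 P_def vector_3 by algebra
    then show ?thesis
      using that by simp
  qed
  have Pm: "((\<lambda>m. X (P m t) $ i) has_field_derivative
      frechet_derivative (\<lambda>p. X p $ i) (at (P m t)) (vector [- t, 3 * m\<^sup>2 * t\<^sup>2, 4 * m ^ 3 * t ^ 3])) (at m)" for i m t
  proof (rule holo_on_chain[OF X UNIV_I])
    fix j
    show "((\<lambda>m. P m t $ j) has_field_derivative vector [- t, 3 * m\<^sup>2 * t\<^sup>2, 4 * m ^ 3 * t ^ 3] $ j) (at m)"
      using exhaust_3[of j] by (auto simp: P_def intro!: derivative_eq_intros)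
  qed
  define g where "g t m = m ^ 4 * t\<^sup>2 * X (P m t) $ 1 - m * (4 + m) * t * X (P m t) $ 2 + (m + 3) * X (P m t) $ 3"
    for t m
  have P0: "P 0 t = axis_pt (- t)" for t
    by (simp add: P_def vec_eq_iff forall_3)
  have g': "(g t has_field_derivative - 4 * t * X (axis_pt (- t)) $ 2 + X (axis_pt (- t)) $ 3
      + 3 * frechet_derivative (\<lambda>p. X p $ 3) (at (axis_pt (- t))) (axis_pt (- t))) (at 0)" for t
  proof -
    have v: "vector [- t, 3 * 0\<^sup>2 * t\<^sup>2, 4 * 0 ^ 3 * t ^ 3] = axis_pt (- t)"
      by (simp add: vec_eq_iff forall_3)
    note D = Pm[of t _ 0, unfolded v P0]
    show ?thesis
      unfolding g_def [abs_def]
      by (rule derivative_eq_intros D refl)+ (simp add: P0 algebra_simps)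
  qed
  have g_zero: "g t m = 0" if "t \<noteq> 0" for t m
    using isCont_eq_zero[OF g', of t] tangent[OF _ that] unfolding g_def by metis
  \<comment> \<open>Order zero in \<open>m\<close>: the value of \<open>g (- x)\<close> at
    \<open>0\<close> is three times the third component.\<close>
  have "X (axis_pt x) $ 3 = 0" if "x \<noteq> 0" for x
    using g_zero[of "- x" 0] that by (simp add: g_def P0)
  then have X3: "X (axis_pt x) $ 3 = 0" for x
    using isCont_eq_zero[OF holo_on_axis[OF X[of 3], of 1 0]] by (cases "x = 0") auto
  \<comment> \<open>Order one in \<open>m\<close>: the third component and its derivative along the
    axis are zero, so only the term with the second component remains.\<close>
  have "X (axis_pt x) $ 2 = 0" if "x \<noteq> 0" for x
  proof -
    have "(g (- x) has_field_derivative 0) (at 0)"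
      using g_zero[of "- x"] that by (simp add: fun_eq_iff[of "g (- x)" "\<lambda>_. 0", THEN iffD2])
    from DERIV_unique[OF g' this] show ?thesis
      using that by (simp add: X3 frechet_axis_zero[OF X X3])
  qed
  then have X2: "X (axis_pt x) $ 2 = 0" for x
    using isCont_eq_zero[OF holo_on_axis[OF X[of 2], of 1 0]] by (cases "x = 0") auto
  \<comment> \<open>At \<open>m = - 3\<close> the coefficient \<open>m + 3\<close> of the third
    component vanishes, and the curve leaves the origin along the \<open>x\<close>-axis with
    velocity \<open>axis_pt 2\<close>.\<close>
  have Pt: "((\<lambda>t. X (P (- 3) t) $ i) has_field_derivative
      frechet_derivative (\<lambda>p. X p $ i) (at 0) (axis_pt 2)) (at 0)" for i
  proof -
    have z: "P (- 3) 0 = 0"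
      by (simp add: P_def vec_eq_iff forall_3)
    have "((\<lambda>t. P (- 3) t $ j) has_field_derivative axis_pt 2 $ j) (at 0)" for j
      using exhaust_3[of j] by (auto simp: P_def intro!: derivative_eq_intros)
    from holo_on_chain[OF X UNIV_I this] show ?thesis
      by (simp add: z)
  qed
  define k where "k t = 27 * t * X (P (- 3) t) $ 1 + X (P (- 3) t) $ 2" for t
  have k': "(k has_field_derivative 27 * X 0 $ 1) (at 0)"
  proof -
    have "P (- 3) 0 = 0"
      by (simp add: P_def vec_eq_iff forall_3)
    moreover have "frechet_derivative (\<lambda>p. X p $ 2) (at 0) (axis_pt 2) = 0"
      using frechet_axis_zero[OF X X2, of 0] by simp
    ultimately show ?thesis
      unfolding k_def [abs_def] by (auto intro!: derivative_eq_intros Pt)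
  qed
  have k_zero: "k t = 0" if "t \<noteq> 0" for t
  proof -
    have "3 * t * k t = 0"
      using tangent[of "- 3" t] that unfolding k_def by (simp add: algebra_simps power2_eq_square)
    then show ?thesis
      using that by simp
  qed
  then have "k t = 0" for t
    using isCont_eq_zero[OF k'] by (cases "t = 0") auto
  then have "(k has_field_derivative 0) (at 0)"
    by (simp add: fun_eq_iff[of k "\<lambda>_. 0", THEN iffD2])
  from DERIV_unique[OF k' this] have "X 0 $ 1 = 0"
    by simp
  then show ?thesis
    using X2[of 0] X3[of 0] by (simp add: vec_eq_iff forall_3)
qed

section \<open>The generators and their brackets\<close>

definition vf_E :: "cspace \<Rightarrow> cspace" where
  "vf_E p = vector [p $ 1, 2 * p $ 2, 3 * p $ 3]"

definition vf_V :: "cspace \<Rightarrow> cspace" where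
  "vf_V p = vector [2 * p $ 2, - 24 * p $ 1 * p $ 2 + 2 * p $ 3, - 2 * (p $ 2)\<^sup>2 - 32 * p $ 1 * p $ 3]"

definition vf_W :: "cspace \<Rightarrow> cspace" where
  "vf_W p = vector [3 * p $ 3, - 9 * (p $ 2)\<^sup>2, - 12 * p $ 2 * p $ 3]"

text \<open>The expansion of \<open>[V, W]\<close> in the generators. Its coefficients vanish at the
  origin; their linear parts produce the contradiction.\<close>

definition vf_VW :: "cspace \<Rightarrow> cspace" where
  "vf_VW p = 24 * p $ 3 *s vf_E p + 6 * p $ 2 *s vf_V p - 40 * p $ 1 *s vf_W p"

lemma vf_nth:
  "vf_E p $ 1 = p $ 1" "vf_E p $ 2 = 2 * p $ 2" "vf_E p $ 3 = 3 * p $ 3"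
  "vf_V p $ 1 = 2 * p $ 2" "vf_V p $ 2 = - 24 * p $ 1 * p $ 2 + 2 * p $ 3"
  "vf_V p $ 3 = - 2 * (p $ 2)\<^sup>2 - 32 * p $ 1 * p $ 3"
  "vf_W p $ 1 = 3 * p $ 3" "vf_W p $ 2 = - 9 * (p $ 2)\<^sup>2" "vf_W p $ 3 = - 12 * p $ 2 * p $ 3"
  by (simp_all add: vf_E_def vf_V_def vf_W_def)

lemma frechet_derivative_applyI:
  "(f has_derivative F) (at p) \<Longrightarrow> F h = y \<Longrightarrow> frechet_derivative f (at p) h = y"
  using frechet_derivative_at by metis

lemma vf_frechet:
  "frechet_derivative (\<lambda>p. vf_E p $ 1) (at p) h = h $ 1"
  "frechet_derivative (\<lambda>p. vf_E p $ 2) (at p) h = 2 * h $ 2"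
  "frechet_derivative (\<lambda>p. vf_E p $ 3) (at p) h = 3 * h $ 3"
  "frechet_derivative (\<lambda>p. vf_V p $ 1) (at p) h = 2 * h $ 2"
  "frechet_derivative (\<lambda>p. vf_V p $ 2) (at p) h = - 24 * (h $ 1 * p $ 2 + p $ 1 * h $ 2) + 2 * h $ 3"
  "frechet_derivative (\<lambda>p. vf_V p $ 3) (at p) h = - 4 * p $ 2 * h $ 2 - 32 * (h $ 1 * p $ 3 + p $ 1 * h $ 3)"
  "frechet_derivative (\<lambda>p. vf_W p $ 1) (at p) h = 3 * h $ 3"
  "frechet_derivative (\<lambda>p. vf_W p $ 2) (at p) h = - 18 * p $ 2 * h $ 2"
  "frechet_derivative (\<lambda>p. vf_W p $ 3) (at p) h = - 12 * (h $ 2 * p $ 3 + p $ 2 * h $ 3)"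
  by (simp_all only: vf_nth)
    (rule frechet_derivative_applyI, (rule derivative_intros)+, simp add: algebra_simps)+

lemma vf_bracket_EV: "vf_bracket vf_E vf_V = vf_V"
  by (rule ext, simp add: vec_eq_iff forall_3 vf_bracket_def vf_apply_def vf_frechet,
      simp add: vf_nth algebra_simps power2_eq_square)

lemma vf_bracket_EW: "vf_bracket vf_E vf_W p = 2 *s vf_W p"
  by (simp add: vec_eq_iff forall_3 vf_bracket_def vf_apply_def vf_frechet,
      simp add: vf_nth algebra_simps power2_eq_square)

lemma vf_bracket_VW: "vf_bracket vf_V vf_W = vf_VW"
  by (rule ext, simp add: vec_eq_iff forall_3 vf_bracket_def vf_apply_def vf_frechet,
      simp add: vf_VW_def vf_nth algebra_simps power2_eq_square)

lemma vf_holo: "holo_on UNIV (\<lambda>p. vf_E p $ i)" "holo_on UNIV (\<lambda>p. vf_V p $ i)"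
  "holo_on UNIV (\<lambda>p. vf_W p $ i)"
  using exhaust_3[of i] by (auto simp: vf_nth intro!: holo_on_intros)

text \<open>Each generator multiplies \<open>F_B5\<close> by a polynomial, hence is tangent to the
  divisor. For \<open>vf_E\<close> this is weighted homogeneity of degree 9 with weights 1, 2,
  3.\<close>

lemma vf_apply_F_B5:
  "frechet_derivative F_B5 (at p) (vf_E p) = 9 * F_B5 p"
  "frechet_derivative F_B5 (at p) (vf_V p) = - 96 * p $ 1 * F_B5 p"
  "frechet_derivative F_B5 (at p) (vf_W p) = - 36 * p $ 2 * F_B5 p"
  unfolding frechet_F_B5 vf_nth F_B5_def by algebra+

lemma frechet_F_B5_linear:
  "frechet_derivative F_B5 (at p) (c *s u) = c * frechet_derivative F_B5 (at p) u"
  "frechet_derivative F_B5 (at p) (u + v) = frechet_derivative F_B5 (at p) u + frechet_derivative F_B5 (at p) v"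
  "frechet_derivative F_B5 (at p) (u - v) = frechet_derivative F_B5 (at p) u - frechet_derivative F_B5 (at p) v"
  by (simp_all add: frechet_F_B5 algebra_simps)

text \<open>The last two fields are the brackets \<open>[V, W]\<close> and \<open>[E, W]\<close>,
  whose sections are computed later.\<close>

lemma vf_log:
  "vf_E \<in> log_vector_fields D_B5 UNIV" "vf_V \<in> log_vector_fields D_B5 UNIV"
  "vf_W \<in> log_vector_fields D_B5 UNIV" "vf_VW \<in> log_vector_fields D_B5 UNIV"
  "(\<lambda>p. 2 *s vf_W p) \<in> log_vector_fields D_B5 UNIV"
  by (rule log_vector_fieldI,
      simp_all add: vf_VW_def vf_holo frechet_F_B5_linear vf_apply_F_B5 vf_nth holo_on_intros)+

section \<open>Trivializing sections\<close>

context complex_lie_algebra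
begin

abbreviation functional :: "('g \<Rightarrow> complex) \<Rightarrow> bool" where
  "functional \<equiv> Vector_Spaces.linear smul (*)"

lemma functionalI:
  "(\<And>a b. l (a + b) = l a + l b) \<Longrightarrow> (\<And>c a. l (smul c a) = c * l a) \<Longrightarrow> functional l"
  by unfold_locales (auto simp: algebra_simps)

lemma functional_add: "functional l \<Longrightarrow> l (a + b) = l a + l b"
  and functional_diff: "functional l \<Longrightarrow> l (a - b) = l a - l b"
  and functional_scale: "functional l \<Longrightarrow> l (smul c a) = c * l a"
  and functional_zero: "functional l \<Longrightarrow> l 0 = 0"
  and functional_sum: "functional l \<Longrightarrow> l (sum g I) = (\<Sum>i\<in>I. l (g i))"
proof -
  assume "functional l"
  then interpret Vector_Spaces.linear smul "(*)" l .
  show "l (a + b) = l a + l b" "l (a - b) = l a - l b" "l (smul c a) = c * l a" "l 0 = 0"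
    "l (sum g I) = (\<Sum>i\<in>I. l (g i))"
    by (simp_all add: add diff scale zero sum)
qed

text \<open>Coordinates are packaged as functionals because holomorphy of maps into the Lie algebra
  is tested by functionals.\<close>

lemma finite_basis:
  obtains B where "finite B" "\<And>b. functional (\<lambda>a. representation B a b)"
    "\<And>a. (\<Sum>b\<in>B. smul (representation B a b) b) = a"
proof -
  obtain S where S: "finite S" "span S = UNIV"
    using finite_dim by blast
  obtain B where B: "B \<subseteq> S" "independent B" "S \<subseteq> span B"
    using maximal_independent_subset[of S] by metis
  have span: "a \<in> span B" for a
    using S(2) span_mono[OF B(3)] span_span by auto
  show thesis
  proof
    show "finite B"
      using B(1) S(1) finite_subset by blast
    then show "(\<Sum>b\<in>B. smul (representation B a b) b) = a" for a
      using sum_representation_eq[OF B(2) span] by simp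
    show "functional (\<lambda>a. representation B a b)" for b
      by (rule functionalI) (simp_all add: representation_add[OF B(2) span span] representation_scale[OF B(2) span])
  qed
qed

lemma functional_separate:
  assumes "\<And>l. functional l \<Longrightarrow> l a = l b"
  shows "a = b"
proof -
  obtain B where B: "finite B" "\<And>b. functional (\<lambda>a. representation B a b)"
    "\<And>a. (\<Sum>b\<in>B. smul (representation B a b) b) = a"
    using finite_basis by blast
  have "(\<Sum>x\<in>B. smul (representation B a x) x) = (\<Sum>x\<in>B. smul (representation B b x) x)"
    by (simp only: assms[OF B(2)])
  then show ?thesis
    by (simp only: B(3))
qed

lemma holo_maps_functional: "s \<in> holo_maps smul U \<Longrightarrow> functional l \<Longrightarrow> holo_on U (\<lambda>p. l (s p))"
  by (simp add: holo_maps_def)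

text \<open>The definite description needs a witness: differentiate the coordinates in a basis. It
  is unique since functionals separate points.\<close>

lemma functional_vf_apply_map:
  assumes s: "s \<in> holo_maps smul U" and p: "p \<in> U" and l: "functional l"
  shows "l (vf_apply_map smul X s p) = vf_apply X (\<lambda>q. l (s q)) p"
proof -
  obtain B where B: "finite B" "\<And>b. functional (\<lambda>a. representation B a b)"
    "\<And>a. (\<Sum>b\<in>B. smul (representation B a b) b) = a"
    using finite_basis by blast
  define c where "c b q = representation B (s q) b" for b q
  have c: "holo_on U (c b)" for b
    using holo_maps_functional[OF s B(2)] by (simp add: c_def [abs_def])
  define w where "w = (\<Sum>b\<in>B. smul (vf_apply X (c b) p) b)"
  have w: "k w = vf_apply X (\<lambda>q. k (s q)) p" if k: "functional k" for k
  proof -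
    have "k (s q) = (\<Sum>b\<in>B. c b q * k b)" for q
      by (subst B(3)[symmetric]) (simp add: functional_sum[OF k] functional_scale[OF k] c_def)
    moreover have "((\<lambda>q. \<Sum>b\<in>B. c b q * k b) has_derivative
        (\<lambda>h. \<Sum>b\<in>B. frechet_derivative (c b) (at p) h * k b)) (at p)"
      by (intro has_derivative_sum has_derivative_mult_left holo_on_deriv(1)[OF c p])
    ultimately have "vf_apply X (\<lambda>q. k (s q)) p = (\<Sum>b\<in>B. frechet_derivative (c b) (at p) (X p) * k b)"
      unfolding vf_apply_def by (intro frechet_derivative_applyI) auto
    then show ?thesis
      by (simp add: w_def functional_sum[OF k] functional_scale[OF k] vf_apply_def)
  qed
  have "vf_apply_map smul X s p = w"
    unfolding vf_apply_map_def
    by (rule the_equality) (use w in \<open>auto intro!: functional_separate\<close>)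
  then show ?thesis
    using w[OF l] by simp
qed

lemma holo_maps_UNIV_I:
  "(\<And>l. functional l \<Longrightarrow> holo_on UNIV (\<lambda>p. l (s p))) \<Longrightarrow> s \<in> holo_maps smul UNIV"
  by (simp add: holo_maps_def extensional_def)

end

section \<open>Consequences of an isomorphism with an action algebroid\<close>

definition det3 :: "cspace \<Rightarrow> cspace \<Rightarrow> cspace \<Rightarrow> complex" where
  "det3 u v w = u $ 1 * (v $ 2 * w $ 3 - v $ 3 * w $ 2) - u $ 2 * (v $ 1 * w $ 3 - v $ 3 * w $ 1)
    + u $ 3 * (v $ 1 * w $ 2 - v $ 2 * w $ 1)"

text \<open>Cramer's rule without division, so that it also holds where \<open>u\<close>,
  \<open>v\<close>, \<open>w\<close> are dependent.\<close>

lemma det3_cramer: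
  "det3 u v w *s b = det3 b v w *s u + det3 u b w *s v + det3 u v b *s w"
  by (simp add: vec_eq_iff forall_3 det3_def algebra_simps)

lemma holo_on_det3:
  assumes "\<And>i. holo_on U (\<lambda>p. X p $ i)" "\<And>i. holo_on U (\<lambda>p. Y p $ i)" "\<And>i. holo_on U (\<lambda>p. Z p $ i)"
  shows "holo_on U (\<lambda>p. det3 (X p) (Y p) (Z p))"
  unfolding det3_def by (intro holo_on_intros assms)

locale log_action_iso = complex_lie_algebra smul br
  for smul :: "complex \<Rightarrow> 'g::ab_group_add \<Rightarrow> 'g" and br +
  fixes \<rho> :: "'g \<Rightarrow> cspace \<Rightarrow> cspace" and \<phi>
  assumes action: "infinitesimal_action smul br \<rho>"
    and iso: "lie_algebroid_iso (log_tangent D_B5) (action_algebroid smul br \<rho>) \<phi>"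
begin

lemma rho_holo: "holo_on UNIV (\<lambda>p. \<rho> a p $ i)"
  using action by (simp add: infinitesimal_action_def holo_vector_fields_def)

lemma rho_add: "\<rho> (a + b) p = \<rho> a p + \<rho> b p"
  and rho_diff: "\<rho> (a - b) p = \<rho> a p - \<rho> b p"
  and rho_scale: "\<rho> (smul c a) p = c *s \<rho> a p"
  and rho_sum: "\<rho> (sum g I) p = (\<Sum>i\<in>I. \<rho> (g i) p)"
proof -
  interpret Vector_Spaces.linear smul "(*s)" "\<lambda>a. \<rho> a p"
    using action by (simp add: infinitesimal_action_def)
  show "\<rho> (a + b) p = \<rho> a p + \<rho> b p" "\<rho> (a - b) p = \<rho> a p - \<rho> b p" "\<rho> (smul c a) p = c *s \<rho> a p"
    "\<rho> (sum g I) p = (\<Sum>i\<in>I. \<rho> (g i) p)"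
    by (simp_all add: add diff scale sum)
qed

abbreviation sec :: "(cspace \<Rightarrow> cspace) \<Rightarrow> cspace \<Rightarrow> 'g" where
  "sec \<equiv> \<phi> UNIV"

lemma sec_bij: "bij_betw sec (log_vector_fields D_B5 UNIV) (holo_maps smul UNIV)"
  using iso by (simp add: lie_algebroid_iso_def log_tangent_def action_algebroid_def)

lemma sec_anchor: "X \<in> log_vector_fields D_B5 UNIV \<Longrightarrow> action_anchor \<rho> UNIV (sec X) = X"
  using iso by (simp add: lie_algebroid_iso_def log_tangent_def action_algebroid_def)

lemma sec_holo: "X \<in> log_vector_fields D_B5 UNIV \<Longrightarrow> sec X \<in> holo_maps smul UNIV"
  using sec_bij bij_betwE by blast

lemma rho_sec: "X \<in> log_vector_fields D_B5 UNIV \<Longrightarrow> \<rho> (sec X p) p = X p"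
  using sec_anchor[of X] by (simp add: action_anchor_def fun_eq_iff)

lemma sec_bracket:
  assumes "X \<in> log_vector_fields D_B5 UNIV" "Y \<in> log_vector_fields D_B5 UNIV"
  shows "sec (vf_bracket X Y) p
    = br (sec X p) (sec Y p) + vf_apply_map smul X (sec Y) p - vf_apply_map smul Y (sec X) p"
proof -
  have "sec (restrict (vf_bracket X Y) UNIV) = (\<lambda>p\<in>UNIV. br (sec X p) (sec Y p)
      + vf_apply_map smul (action_anchor \<rho> UNIV (sec X)) (sec Y) p
      - vf_apply_map smul (action_anchor \<rho> UNIV (sec Y)) (sec X) p)"
    using iso assms by (simp add: lie_algebroid_iso_def log_tangent_def action_algebroid_def)
  then show ?thesis
    using assms by (simp add: sec_anchor fun_eq_iff restrict_def)
qed

text \<open>Every section is \<open>sec X\<close> for some logarithmic field \<open>X\<close>, and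
  the anchor recovers \<open>X\<close> from it.\<close>

lemma section_eqI:
  assumes "s \<in> holo_maps smul UNIV" "t \<in> holo_maps smul UNIV" "\<And>p. \<rho> (s p) p = \<rho> (t p) p"
  shows "s = t"
proof -
  obtain X Y where XY: "X \<in> log_vector_fields D_B5 UNIV" "s = sec X"
      "Y \<in> log_vector_fields D_B5 UNIV" "t = sec Y"
    using assms(1,2) sec_bij unfolding bij_betw_def by blast
  have "X = Y"
    using assms(3) rho_sec[OF XY(1)] rho_sec[OF XY(3)] XY by (simp add: fun_eq_iff)
  with XY show ?thesis
    by simp
qed

text \<open>The constant section \<open>a\<close> comes from some logarithmic field, and its anchor
  is \<open>\<rho> a\<close>.\<close>

lemma rho_log: "\<rho> a \<in> log_vector_fields D_B5 UNIV"
proof -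
  have "(\<lambda>p. a) \<in> holo_maps smul UNIV"
    by (rule holo_maps_UNIV_I) (rule holo_on_const)
  then obtain X where X: "X \<in> log_vector_fields D_B5 UNIV" "(\<lambda>p. a) = sec X"
    using sec_bij unfolding bij_betw_def by blast
  then have "X = \<rho> a"
    using rho_sec[OF X(1)] by (simp add: fun_eq_iff X(2)[symmetric])
  with X show ?thesis
    by simp
qed

lemma rho_zero: "\<rho> a 0 = 0"
  by (rule log_vector_field_zero[OF rho_log])

text \<open>The first component of the linear part at the origin suffices to separate the
  generators, where it is \<open>x\<close>, \<open>2y\<close> and \<open>3z\<close>.\<close>

definition lin :: "cspace \<Rightarrow> 'g \<Rightarrow> complex" where
  "lin h a = frechet_derivative (\<lambda>p. \<rho> a p $ 1) (at 0) h"

lemma lin_functional: "functional (lin h)"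
proof (rule functionalI)
  note D = holo_on_deriv(1)[OF rho_holo UNIV_I]
  show "lin h (a + b) = lin h a + lin h b" for a b
    unfolding lin_def rho_add vector_add_component
    by (rule frechet_derivative_applyI) (rule has_derivative_add D refl)+
  show "lin h (smul c a) = c * lin h a" for c a
    unfolding lin_def rho_scale vector_smult_component
    by (rule frechet_derivative_applyI) (rule has_derivative_mult_right D refl)+
qed

text \<open>Since every \<open>\<rho> a\<close> vanishes at the origin, differentiating \<open>X p = \<rho> (sec X p) p\<close> there does not
  see the derivative of \<open>sec X\<close>.\<close>

lemma lin_sec:
  assumes X: "X \<in> log_vector_fields D_B5 UNIV"
  shows "lin h (sec X 0) = frechet_derivative (\<lambda>p. X p $ 1) (at 0) h"
proof -
  obtain B where B: "finite B" "\<And>b. functional (\<lambda>a. representation B a b)"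
    "\<And>a. (\<Sum>b\<in>B. smul (representation B a b) b) = a"
    using finite_basis by blast
  define c where "c b q = representation B (sec X q) b" for b q
  have c: "holo_on UNIV (c b)" for b
    using holo_maps_functional[OF sec_holo[OF X] B(2)] by (simp add: c_def [abs_def])
  have sec_eq: "sec X p = (\<Sum>b\<in>B. smul (c b p) b)" for p
    by (simp add: c_def B(3))
  have "X p $ 1 = (\<Sum>b\<in>B. c b p * \<rho> b p $ 1)" for p
    by (subst rho_sec[OF X, symmetric], subst sec_eq) (simp add: rho_sum rho_scale)
  then have "frechet_derivative (\<lambda>p. X p $ 1) (at 0) h
      = frechet_derivative (\<lambda>p. \<Sum>b\<in>B. c b p * \<rho> b p $ 1) (at 0) h"
    by simp
  also have "\<dots> = (\<Sum>b\<in>B. c b 0 * lin h b)"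
    by (rule frechet_derivative_applyI, rule has_derivative_sum,
        rule has_derivative_mult[OF holo_on_deriv(1)[OF c UNIV_I] holo_on_deriv(1)[OF rho_holo UNIV_I]])
      (simp add: rho_zero lin_def)
  also have "\<dots> = lin h (sec X 0)"
    by (simp add: sec_eq functional_sum[OF lin_functional] functional_scale[OF lin_functional])
  finally show ?thesis
    by simp
qed

end

section \<open>The bracket relation in coordinates\<close>

lemma pd_axis_deriv:
  assumes "holo_on UNIV f"
  shows "((\<lambda>s. f (s *s axis i 1)) has_field_derivative pd i f (s *s axis i 1)) (at s)"
  unfolding pd_def
proof (rule holo_on_chain[OF assms UNIV_I])
  fix j
  show "((\<lambda>s. (s *s axis i 1 :: cspace) $ j) has_field_derivative axis i 1 $ j) (at s)"
    by (auto simp: axis_def intro!: derivative_eq_intros)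
qed

lemma vf_apply_pd:
  "holo_on UNIV f \<Longrightarrow> vf_apply X f p = X p $ 1 * pd 1 f p + X p $ 2 * pd 2 f p + X p $ 3 * pd 3 f p"
  unfolding vf_apply_def by (subst frechet_eq_pd) (auto simp: sum_3)

context log_action_iso
begin

section \<open>A basis of the Lie algebra\<close>

definition e where "e = sec vf_E 0"
definition v where "v = sec vf_V 0"
definition w where "w = sec vf_W 0"

text \<open>\<open>lam_e\<close>, \<open>lam_v\<close>, \<open>lam_w\<close> are dual to
  \<open>e\<close>, \<open>v\<close>, \<open>w\<close>; the divisors 2 and 3 normalize the first
  components \<open>2y\<close> of \<open>V\<close> and \<open>3z\<close> of
  \<open>W\<close>.\<close>

definition lam_e :: "'g \<Rightarrow> complex" where "lam_e = lin (axis 1 1)"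
definition lam_v :: "'g \<Rightarrow> complex" where "lam_v a = lin (axis 2 1) a / 2"
definition lam_w :: "'g \<Rightarrow> complex" where "lam_w a = lin (axis 3 1) a / 3"

lemma lam_functional: "functional lam_e" "functional lam_v" "functional lam_w"
proof -
  note L = lin_functional
  show "functional lam_e"
    unfolding lam_e_def by (rule L)
  show "functional lam_v" "functional lam_w"
    unfolding lam_v_def [abs_def] lam_w_def [abs_def]
    by (rule functionalI; simp add: functional_add[OF L] functional_scale[OF L] add_divide_distrib)+
qed

lemma lam_basis:
  "lam_e e = 1" "lam_e v = 0" "lam_e w = 0"
  "lam_v e = 0" "lam_v v = 1" "lam_v w = 0"
  "lam_w e = 0" "lam_w v = 0" "lam_w w = 1"
  by (simp_all add: lam_e_def lam_v_def lam_w_def e_def v_def w_def lin_sec vf_log vf_frechet axis_def)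

lemma indep: "independent {e, v, w}" "card {e, v, w} = 3"
proof -
  have d: "e \<noteq> v" "e \<noteq> w" "v \<noteq> w"
    using lam_basis by force+
  then show "card {e, v, w} = 3"
    by simp
  have "u e = 0 \<and> u v = 0 \<and> u w = 0"
    if "smul (u e) e + (smul (u v) v + smul (u w) w) = 0" for u
  proof -
    have "l (smul (u e) e + (smul (u v) v + smul (u w) w)) = 0" if "functional l" for l
      using \<open>_ = 0\<close> functional_zero[OF that] by simp
    from this[OF lam_functional(1)] this[OF lam_functional(2)] this[OF lam_functional(3)]
    show ?thesis
      by (simp add: functional_add[OF lam_functional(1)] functional_add[OF lam_functional(2)]
          functional_add[OF lam_functional(3)] functional_scale[OF lam_functional(1)]
          functional_scale[OF lam_functional(2)] functional_scale[OF lam_functional(3)] lam_basis)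
  qed
  then show "independent {e, v, w}"
    using d by (auto simp: dependent_finite)
qed

text \<open>Cramer's rule expresses a constant section through three others wherever their anchors are
  independent, so injectivity of the anchor on sections bounds the dimension of the Lie algebra.\<close>

lemma spanned_by_three: "\<exists>a1 a2 a3. \<forall>b. b \<in> span {a1, a2, a3}"
proof -
  \<comment> \<open>A point off the divisor, where the three generators are linearly
    independent.\<close>
  define p0 :: cspace where "p0 = vector [0, 0, 1]"
  define a1 where "a1 = sec vf_E p0"
  define a2 where "a2 = sec vf_V p0"
  define a3 where "a3 = sec vf_W p0"
  define d where "d b1 b2 b3 p = det3 (\<rho> b1 p) (\<rho> b2 p) (\<rho> b3 p)" for b1 b2 b3 p
  have d: "holo_on UNIV (d b1 b2 b3)" for b1 b2 b3
    unfolding d_def [abs_def] by (intro holo_on_det3 rho_holo)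
  have d0: "d a1 a2 a3 p0 \<noteq> 0"
    by (simp add: d_def a1_def a2_def a3_def rho_sec vf_log det3_def vf_nth p0_def)
  have "b \<in> span {a1, a2, a3}" for b
  proof -
    \<comment> \<open>Both sides have the same anchor by Cramer's rule, hence agree as sections; at
      \<open>p0\<close> the coefficient of \<open>b\<close> is invertible.\<close>
    have "(\<lambda>p. smul (d a1 a2 a3 p) b)
        = (\<lambda>p. smul (d b a2 a3 p) a1 + smul (d a1 b a3 p) a2 + smul (d a1 a2 b p) a3)"
    proof (rule section_eqI)
      show "(\<lambda>p. smul (d a1 a2 a3 p) b) \<in> holo_maps smul UNIV"
        by (rule holo_maps_UNIV_I) (simp add: functional_scale holo_on_intros d)
      show "(\<lambda>p. smul (d b a2 a3 p) a1 + smul (d a1 b a3 p) a2 + smul (d a1 a2 b p) a3) \<in> holo_maps smul UNIV"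
        by (rule holo_maps_UNIV_I) (simp add: functional_add functional_scale holo_on_intros d)
      show "\<rho> (smul (d a1 a2 a3 p) b) p
          = \<rho> (smul (d b a2 a3 p) a1 + smul (d a1 b a3 p) a2 + smul (d a1 a2 b p) a3) p" for p
        unfolding rho_add rho_scale d_def by (rule det3_cramer)
    qed
    then have "smul (d a1 a2 a3 p0) b
        = smul (d b a2 a3 p0) a1 + smul (d a1 b a3 p0) a2 + smul (d a1 a2 b p0) a3"
      by (rule fun_cong)
    also have "\<dots> \<in> span {a1, a2, a3}"
      by (intro span_add span_scale span_base) auto
    finally have "smul (1 / d a1 a2 a3 p0) (smul (d a1 a2 a3 p0) b) \<in> span {a1, a2, a3}"
      by (rule span_scale)
    then show ?thesis
      using d0 by simp
  qed
  then show ?thesis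
    by blast
qed

text \<open>A vector outside the span would give four independent vectors in a space spanned by
  three.\<close>

lemma span_evw: "b \<in> span {e, v, w}"
proof (rule ccontr)
  assume b: "b \<notin> span {e, v, w}"
  then have b': "b \<notin> {e, v, w}"
    by (rule contrapos_nn) (rule span_base)
  obtain a1 a2 a3 where a: "\<And>b. b \<in> span {a1, a2, a3}"
    using spanned_by_three by metis
  have "independent (insert b {e, v, w})"
    using indep(1) b by (rule independent_insertI[rotated])
  moreover have "insert b {e, v, w} \<subseteq> span {a1, a2, a3}"
    using a by blast
  ultimately have "card (insert b {e, v, w}) \<le> card {a1, a2, a3}"
    using independent_span_bound[of "{a1, a2, a3}"] by blast
  moreover have "card {a1, a2, a3} \<le> 3"
    by (simp add: card_insert_if)
  moreover have "card (insert b {e, v, w}) = 4"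
    using b' indep(2) by (subst card_insert_disjoint) auto
  ultimately show False
    by simp
qed

lemma expand: "a = smul (lam_e a) e + smul (lam_v a) v + smul (lam_w a) w"
proof -
  have "a \<in> span (insert e (insert v (insert w {})))"
    by (rule span_evw)
  then obtain c1 c2 c3 where "a - smul c1 e - smul c2 v - smul c3 w = 0"
    unfolding span_breakdown_eq span_empty singleton_iff by blast
  then have a: "a = smul c1 e + smul c2 v + smul c3 w"
    by (simp add: algebra_simps)
  have "lam_e a = c1" "lam_v a = c2" "lam_w a = c3"
    unfolding a by (simp_all add: functional_add[OF lam_functional(1)] functional_add[OF lam_functional(2)]
        functional_add[OF lam_functional(3)] functional_scale[OF lam_functional(1)]
        functional_scale[OF lam_functional(2)] functional_scale[OF lam_functional(3)] lam_basis)
  then show ?thesis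
    using a by simp
qed

section \<open>Brackets of sections and structure constants\<close>

lemma functional_sec_bracket:
  assumes X: "X \<in> log_vector_fields D_B5 UNIV" and Y: "Y \<in> log_vector_fields D_B5 UNIV"
    and l: "functional l"
  shows "l (sec (vf_bracket X Y) p) = l (br (sec X p) (sec Y p))
    + vf_apply X (\<lambda>q. l (sec Y q)) p - vf_apply Y (\<lambda>q. l (sec X q)) p"
  unfolding sec_bracket[OF X Y]
  by (simp add: functional_add[OF l] functional_diff[OF l] l
      functional_vf_apply_map[OF sec_holo[OF X]] functional_vf_apply_map[OF sec_holo[OF Y]])

text \<open>Both fields vanish at the origin, so the two derivative terms of the bracket drop
  out.\<close>

lemma sec_bracket_0:
  assumes X: "X \<in> log_vector_fields D_B5 UNIV" and Y: "Y \<in> log_vector_fields D_B5 UNIV"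
  shows "sec (vf_bracket X Y) 0 = br (sec X 0) (sec Y 0)"
proof (rule functional_separate)
  fix l assume l: "functional l"
  have "holo_on UNIV (\<lambda>q. l (sec X q))" "holo_on UNIV (\<lambda>q. l (sec Y q))"
    using holo_maps_functional[OF sec_holo l] X Y by auto
  then show "l (sec (vf_bracket X Y) 0) = l (br (sec X 0) (sec Y 0))"
    using log_vector_field_zero[OF X] log_vector_field_zero[OF Y]
    by (simp add: functional_sec_bracket[OF X Y l] vf_apply_pd)
qed

lemma sec_VW: "sec vf_VW p
  = smul (24 * p $ 3) (sec vf_E p) + smul (6 * p $ 2) (sec vf_V p) - smul (40 * p $ 1) (sec vf_W p)"
proof -
  have "sec vf_VW = (\<lambda>p. smul (24 * p $ 3) (sec vf_E p) + smul (6 * p $ 2) (sec vf_V p)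
      - smul (40 * p $ 1) (sec vf_W p))"
  proof (rule section_eqI[OF sec_holo])
    show "(\<lambda>p. smul (24 * p $ 3) (sec vf_E p) + smul (6 * p $ 2) (sec vf_V p)
        - smul (40 * p $ 1) (sec vf_W p)) \<in> holo_maps smul UNIV"
      by (rule holo_maps_UNIV_I)
        (simp add: functional_add functional_diff functional_scale holo_on_intros
          holo_maps_functional[OF sec_holo] vf_log)
  qed (simp_all add: vf_log rho_sec rho_add rho_diff rho_scale vf_VW_def)
  then show ?thesis
    by simp
qed

lemma sec_2W: "sec (\<lambda>p. 2 *s vf_W p) = (\<lambda>p. smul 2 (sec vf_W p))"
proof (rule section_eqI[OF sec_holo])
  show "(\<lambda>p. smul 2 (sec vf_W p)) \<in> holo_maps smul UNIV"
    by (rule holo_maps_UNIV_I)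
      (simp add: functional_scale holo_on_intros holo_maps_functional[OF sec_holo] vf_log)
qed (simp_all add: vf_log rho_sec rho_scale)

text \<open>Brackets of the generators evaluated at the origin; there all coefficients of
  \<open>[V, W]\<close> are zero.\<close>

lemma br_basis: "br e v = v" "br e w = smul 2 w" "br v w = 0"
proof -
  show "br e v = v"
    using sec_bracket_0[OF vf_log(1,2)] by (simp add: vf_bracket_EV e_def v_def)
  have "vf_bracket vf_E vf_W = (\<lambda>p. 2 *s vf_W p)"
    by (rule ext) (rule vf_bracket_EW)
  then show "br e w = smul 2 w"
    using sec_bracket_0[OF vf_log(1,3)] by (simp add: sec_2W e_def w_def)
  show "br v w = 0"
    using sec_bracket_0[OF vf_log(2,3)] by (simp add: vf_bracket_VW sec_VW v_def w_def)
qed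

lemma br_add: "br (a + b) c = br a c + br b c" "br c (a + b) = br c a + br c b"
  and br_scale: "br (smul k a) b = smul k (br a b)" "br a (smul k b) = smul k (br a b)"
proof -
  interpret L: Vector_Spaces.linear smul smul "\<lambda>a. br a x" for x
    by (rule br_linear_left)
  interpret R: Vector_Spaces.linear smul smul "\<lambda>b. br x b" for x
    by (rule br_linear_right)
  show "br (a + b) c = br a c + br b c" "br c (a + b) = br c a + br c b"
    "br (smul k a) b = smul k (br a b)" "br a (smul k b) = smul k (br a b)"
    using L.add R.add L.scale R.scale by auto
qed

lemma br_anti: "br b a = - br a b"
  using br_alternating[of "a + b"] unfolding br_add
  by (simp add: br_alternating eq_neg_iff_add_eq_0 add.commute)

lemma lam_br:
  "lam_e (br a b) = 0"
  "lam_v (br a b) = lam_e a * lam_v b - lam_v a * lam_e b"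
  "lam_w (br a b) = 2 * (lam_e a * lam_w b - lam_w a * lam_e b)"
proof -
  have "br a b = smul (lam_e a * lam_v b - lam_v a * lam_e b) v
      + smul (2 * (lam_e a * lam_w b - lam_w a * lam_e b)) w"
    by (subst expand[of a], subst expand[of b])
      (simp add: br_add br_scale br_basis br_alternating br_anti[of _ e] br_anti[of w v]
        scale_left_diff_distrib scale_right_distrib algebra_simps)
  then show "lam_e (br a b) = 0"
    "lam_v (br a b) = lam_e a * lam_v b - lam_v a * lam_e b"
    "lam_w (br a b) = 2 * (lam_e a * lam_w b - lam_w a * lam_e b)"
    by (simp_all add: functional_add[OF lam_functional(1)] functional_add[OF lam_functional(2)]
        functional_add[OF lam_functional(3)] functional_scale[OF lam_functional(1)]
        functional_scale[OF lam_functional(2)] functional_scale[OF lam_functional(3)] lam_basis)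
qed

text \<open>Two computations of the section of \<open>[V, W]\<close>: from its expansion in the
  generators, and from the Leibniz formula for the bracket.\<close>

lemma bracket_equation:
  assumes l: "functional l"
  shows "24 * p $ 3 * l (sec vf_E p) + 6 * p $ 2 * l (sec vf_V p) - 40 * p $ 1 * l (sec vf_W p)
    = l (br (sec vf_V p) (sec vf_W p))
      + vf_apply vf_V (\<lambda>q. l (sec vf_W q)) p - vf_apply vf_W (\<lambda>q. l (sec vf_V q)) p"
  unfolding functional_sec_bracket[OF vf_log(2,3) l, unfolded vf_bracket_VW, symmetric] sec_VW
  by (simp add: functional_add[OF l] functional_diff[OF l] functional_scale[OF l])

section \<open>First-order comparison along the coordinate axes\<close>

lemma contradiction: False
proof -
  \<comment> \<open>The first letter names the field, the second the component of its
    section.\<close>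
  define ve where "ve p = lam_e (sec vf_V p)" for p
  define vv where "vv p = lam_v (sec vf_V p)" for p
  define ee where "ee p = lam_e (sec vf_E p)" for p
  define we where "we p = lam_e (sec vf_W p)" for p
  define wv where "wv p = lam_v (sec vf_W p)" for p
  define vw where "vw p = lam_w (sec vf_V p)" for p
  define ww where "ww p = lam_w (sec vf_W p)" for p
  note defs = ve_def vv_def ee_def we_def wv_def vw_def ww_def
  have holo: "holo_on UNIV ve" "holo_on UNIV vv" "holo_on UNIV ee" "holo_on UNIV we"
    "holo_on UNIV wv" "holo_on UNIV vw" "holo_on UNIV ww"
    unfolding defs [abs_def]
    by (intro holo_maps_functional[OF sec_holo] vf_log lam_functional)+
  have at0: "ve 0 = 0" "vv 0 = 1" "ee 0 = 1" "we 0 = 0" "wv 0 = 0" "vw 0 = 0" "ww 0 = 1"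
    using lam_basis by (simp_all add: defs e_def v_def w_def)
  have e_eq: "24 * p $ 3 * ee p + 6 * p $ 2 * ve p - 40 * p $ 1 * we p
      = vf_apply vf_V we p - vf_apply vf_W ve p" for p
    using bracket_equation[OF lam_functional(1), of p] by (simp add: lam_br defs [abs_def])
  have v_eq: "24 * p $ 3 * lam_v (sec vf_E p) + 6 * p $ 2 * vv p - 40 * p $ 1 * wv p
      = ve p * wv p - vv p * we p + vf_apply vf_V wv p - vf_apply vf_W vv p" for p
    using bracket_equation[OF lam_functional(2), of p] by (simp add: lam_br defs [abs_def])
  have w_eq: "24 * p $ 3 * lam_w (sec vf_E p) + 6 * p $ 2 * vw p - 40 * p $ 1 * ww p
      = 2 * (ve p * ww p - vw p * we p) + vf_apply vf_V ww p - vf_apply vf_W vw p" for p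
    using bracket_equation[OF lam_functional(3), of p] by (simp add: lam_br defs [abs_def])
  define pt :: "3 \<Rightarrow> complex \<Rightarrow> cspace" where "pt i s = s *s axis i 1" for i s
  have pt_nth: "pt i s $ j = (if i = j then s else 0)" for i j s
    by (simp add: pt_def axis_def)
  have pt0: "pt i 0 = 0" for i
    by (simp add: pt_def)
  have der: "((\<lambda>s. f (pt i s)) has_field_derivative pd i f (pt i s)) (at s)" if "holo_on UNIV f" for f i s
    unfolding pt_def by (rule pd_axis_deriv[OF that])
  have der0: "((\<lambda>s. f (pt i s)) has_field_derivative pd i f 0) (at 0)" if "holo_on UNIV f" for f i
    using der[OF that, of i 0] by (simp add: pt0)
  have pd_diff: "\<exists>d. ((\<lambda>s. pd j f (pt i s)) has_field_derivative d) (at 0)" if "holo_on UNIV f" for f i j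
    using der0[OF holo_on_pd[OF open_UNIV that]] by blast
  \<comment> \<open>The equation for \<open>ve\<close> on the \<open>x\<close>-axis is divided by
    \<open>ww\<close>, which is \<open>1\<close> at the origin.\<close>
  have "\<forall>\<^sub>F s in nhds 0. ww (pt 1 s) \<noteq> 0"
  proof -
    have "isCont (\<lambda>s. ww (pt 1 s)) 0"
      using der[OF holo(7)] by (rule DERIV_isCont)
    then have "((\<lambda>s. ww (pt 1 s)) \<longlongrightarrow> 1) (nhds 0)"
      using tendsto_at_iff_tendsto_nhds[of "\<lambda>s. ww (pt 1 s)" 0] by (simp add: isCont_def pt0 at0)
    then show ?thesis
      by (rule tendsto_imp_eventually_ne) simp
  qed
  then have "\<forall>\<^sub>F s in nhds 0. ve (pt 1 s) = - 20 * s \<and> wv (pt 1 s) = 0"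
  proof eventually_elim
    case (elim s)
    show ?case
    proof (cases "s = 0")
      case False
      \<comment> \<open>\<open>V\<close> and \<open>W\<close> vanish on the \<open>x\<close>-axis,
        so the three equations become algebraic there.\<close>
      have zero: "vf_apply vf_V f (pt 1 s) = 0" "vf_apply vf_W f (pt 1 s) = 0" if "holo_on UNIV f" for f
        by (simp_all add: vf_apply_pd[OF that] vf_nth pt_nth)
      have we: "we (pt 1 s) = 0"
        using e_eq[of "pt 1 s"] False by (simp add: pt_nth zero holo)
      have "- 40 * s * ww (pt 1 s) = 2 * (ve (pt 1 s) * ww (pt 1 s))"
        using w_eq[of "pt 1 s"] by (simp add: pt_nth zero holo we)
      then have "(ve (pt 1 s) + 20 * s) * ww (pt 1 s) = 0"
        by algebra
      then have ve: "ve (pt 1 s) = - 20 * s"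
        using elim by (simp add: add_eq_0_iff2)
      \<comment> \<open>The bracket contributes \<open>- 20 * s * wv\<close>, which cancels only
        half of the term \<open>- 40 * s * wv\<close>.\<close>
      have "20 * s * wv (pt 1 s) = 0"
        using v_eq[of "pt 1 s"] by (simp add: pt_nth zero holo we ve algebra_simps)
      with ve False show ?thesis
        by simp
    qed (simp add: pt0 at0)
  qed
  then have ev: "\<forall>\<^sub>F s in nhds 0. ve (pt 1 s) = - 20 * s" "\<forall>\<^sub>F s in nhds 0. wv (pt 1 s) = 0"
    by (auto elim: eventually_mono)
  have "((\<lambda>s. ve (pt 1 s)) has_field_derivative - 20) (at 0)"
    by (subst DERIV_cong_ev[OF refl ev(1) refl]) (auto intro!: derivative_eq_intros)
  then have ve_x: "pd 1 ve 0 = - 20"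
    using DERIV_unique[OF der0[OF holo(1)]] by blast
  have "((\<lambda>s. wv (pt 1 s)) has_field_derivative 0) (at 0)"
    by (subst DERIV_cong_ev[OF refl ev(2) refl]) auto
  then have wv_x: "pd 1 wv 0 = 0"
    using DERIV_unique[OF der0[OF holo(5)]] by blast
  have we_y: "pd 2 we 0 = - 6"
  proof -
    \<comment> \<open>These second derivatives only have to exist: each is multiplied by a factor
      vanishing at \<open>0\<close>.\<close>
    obtain d1 d2 d3 where d:
      "((\<lambda>s. pd 1 wv (pt 2 s)) has_field_derivative d1) (at 0)"
      "((\<lambda>s. pd 3 wv (pt 2 s)) has_field_derivative d2) (at 0)"
      "((\<lambda>s. pd 2 vv (pt 2 s)) has_field_derivative d3) (at 0)"
      using pd_diff[OF holo(5)] pd_diff[OF holo(2)] by metis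
    \<comment> \<open>The \<open>v\<close>-equation on the \<open>y\<close>-axis, where
      \<open>V = (2y, 0, - 2 * y^2)\<close> and \<open>W = (0, - 9 * y^2, 0)\<close>.\<close>
    define h where "h s = ve (pt 2 s) * wv (pt 2 s) - vv (pt 2 s) * we (pt 2 s)
      + 2 * s * pd 1 wv (pt 2 s) - 2 * s\<^sup>2 * pd 3 wv (pt 2 s) + 9 * s\<^sup>2 * pd 2 vv (pt 2 s)
      - 6 * s * vv (pt 2 s)" for s
    have "h s = 0" for s
      using v_eq[of "pt 2 s"] by (simp add: h_def pt_nth vf_apply_pd holo vf_nth algebra_simps)
    then have "(h has_field_derivative 0) (at 0)"
      by (simp add: fun_eq_iff[of h "\<lambda>_. 0", THEN iffD2])
    moreover have "(h has_field_derivative - pd 2 we 0 + 2 * pd 1 wv 0 - 6) (at 0)"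
      unfolding h_def [abs_def]
      by (rule derivative_eq_intros d der0 holo refl)+ (simp add: pt0 at0)
    ultimately have "- pd 2 we 0 + 2 * pd 1 wv 0 - 6 = 0"
      using DERIV_unique by blast
    then have "- pd 2 we 0 - 6 = 0"
      by (simp add: wv_x)
    then show ?thesis
      by algebra
  qed
  \<comment> \<open>The \<open>e\<close>-equation on the \<open>z\<close>-axis divided by
    \<open>z\<close>; there \<open>V = (0, 2z, 0)\<close> and \<open>W = (3z, 0, 0)\<close>.\<close>
  define h where "h s = 24 * ee (pt 3 s) - 2 * pd 2 we (pt 3 s) + 3 * pd 1 ve (pt 3 s)" for s
  obtain d1 d2 where d:
    "((\<lambda>s. pd 2 we (pt 3 s)) has_field_derivative d1) (at 0)"
    "((\<lambda>s. pd 1 ve (pt 3 s)) has_field_derivative d2) (at 0)"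
    using pd_diff[OF holo(4)] pd_diff[OF holo(1)] by metis
  have "(h has_field_derivative 24 * pd 3 ee 0 - 2 * d1 + 3 * d2) (at 0)"
    unfolding h_def [abs_def] by (rule derivative_eq_intros d der0 holo refl)+ simp
  moreover have "h s = 0" if "s \<noteq> 0" for s
  proof -
    have "s * h s = 0"
      using e_eq[of "pt 3 s"] by (simp add: h_def pt_nth vf_apply_pd holo vf_nth algebra_simps)
    then show ?thesis
      using that by simp
  qed
  ultimately have "h 0 = 0"
    by (rule isCont_eq_zero)
  \<comment> \<open>The value of \<open>h\<close> at \<open>0\<close> is
    \<open>24 + 12 - 60 = - 24\<close>.\<close>
  then show False
    by (simp add: h_def pt0 at0 ve_x we_y)
qed

end

theorem corollary5p20:
  fixes smul :: "complex \<Rightarrow> 'g::ab_group_add \<Rightarrow> 'g"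
    and br :: "'g \<Rightarrow> 'g \<Rightarrow> 'g"
    and \<rho> :: "'g \<Rightarrow> cspace \<Rightarrow> cspace"
  assumes "complex_lie_algebra smul br"
    and "infinitesimal_action smul br \<rho>"
  shows "\<not> lie_algebroid_isomorphic (log_tangent D_B5) (action_algebroid smul br \<rho>)"
proof
  assume "lie_algebroid_isomorphic (log_tangent D_B5) (action_algebroid smul br \<rho>)"
  then obtain \<phi> where "lie_algebroid_iso (log_tangent D_B5) (action_algebroid smul br \<rho>) \<phi>"
    unfolding lie_algebroid_isomorphic_def by blast
  with assms interpret log_action_iso smul br \<rho> \<phi>
    by (simp add: log_action_iso_def log_action_iso_axioms_def)
  show False
    by (rule contradiction)
qed

end
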